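(* Let $\mathbf{x}$ be a recurrent infinite binary word having property $\mathrm{TM}(k)$ for some $k\ge 1$. Then there exists an infinite binary word $\mathbf{y}$ such that $\mathbf{x}=u\varphi^k(\mathbf{y})$, where $u$ is a proper (possibly empty) suffix of $\varphi^k(0)$ or of $\varphi^k(1)$.
   Context: $\varphi$ is the Thue--Morse morphism $0\mapsto01$, $1\mapsto10$ and $\mathbf{t}$ its fixed point starting with $0$. For words $u,w$, $\binom{u}{w}$ is the number of occurrences of $w$ as a scattered subword of $u$; $u\sim_j v$ if $\binom{u}{x}=\binom{v}{x}$ for all words $x$ of length at most $j$. The $j$-binomial complexity $b^{(j)}_{\mathbf{x}}(n)$ of an infinite word $\mathbf{x}$ is the number of $\sim_j$-classes among its length-$n$ factors. A binary word $\mathbf{x}$ has property $\mathrm{TM}(k)$ if $b^{(j)}_{\mathbf{x}}=b^{(j)}_{\mathbf{t}}$ for all $1\le j\le k$. A word is recurrent if each of its factors occurs infinitely often in it. *)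

theory Defs
  imports "HOL-Library.Stream" "HOL-Library.Sublist"
begin

text \<open>Binary words are over \<^typ>\<open>bool\<close>: the letter 0 is \<^term>\<open>False\<close>, the letter 1 is \<^term>\<open>True\<close>.\<close>

definition morph :: "('a \<Rightarrow> 'b list) \<Rightarrow> 'a list \<Rightarrow> 'b list" where
  "morph h w = concat (map h w)"

text \<open>Meaningful for non-erasing morphisms, i.e. if no \<^term>\<open>h a\<close> is empty.\<close>

definition smorph :: "('a \<Rightarrow> 'b list) \<Rightarrow> 'a stream \<Rightarrow> 'b stream" where
  "smorph h s = flat (smap h s)"

definition tm_letter :: "bool \<Rightarrow> bool list" where
  "tm_letter a = [a, \<not> a]"

definition tm_morph :: "bool list \<Rightarrow> bool list" where
  "tm_morph = morph tm_letter"

definition tm_smorph :: "bool stream \<Rightarrow> bool stream" where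
  "tm_smorph = smorph tm_letter"

definition thue_morse :: "bool stream" where
  "thue_morse = (THE s. tm_smorph s = s \<and> shd s = False)"

text \<open>Occurrences are counted by position sets, so equal words at different positions count separately.\<close>

definition subword_count :: "'a list \<Rightarrow> 'a list \<Rightarrow> nat" where
  "subword_count u w = card {I. I \<subseteq> {..<length u} \<and> nths u I = w}"

definition binom_equiv :: "nat \<Rightarrow> 'a list \<Rightarrow> 'a list \<Rightarrow> bool" where
  "binom_equiv j u v \<longleftrightarrow> (\<forall>x. length x \<le> j \<longrightarrow> subword_count u x = subword_count v x)"

definition occurs_at :: "'a list \<Rightarrow> 'a stream \<Rightarrow> nat \<Rightarrow> bool" where
  "occurs_at w s i \<longleftrightarrow> stake (length w) (sdrop i s) = w"

definition factors :: "'a stream \<Rightarrow> 'a list set" where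
  "factors s = {w. \<exists>i. occurs_at w s i}"

definition binom_complexity :: "nat \<Rightarrow> 'a::finite stream \<Rightarrow> nat \<Rightarrow> nat" where
  "binom_complexity j s n =
     card ({w \<in> factors s. length w = n} // {(u, v). binom_equiv j u v})"

definition TM :: "nat \<Rightarrow> bool stream \<Rightarrow> bool" where
  "TM k s \<longleftrightarrow> (\<forall>j\<in>{1..k}. binom_complexity j s = binom_complexity j thue_morse)"

definition recurrent :: "'a stream \<Rightarrow> bool" where
  "recurrent s \<longleftrightarrow> (\<forall>w\<in>factors s. infinite {i. occurs_at w s i})"

lemma stream_snth_eq: "s = t \<longleftrightarrow> (\<forall>n. s !! n = t !! n)"
  by (metis ext stream_smap_nats)

lemma tm_smorph_SCons: "tm_smorph (a ## s) = a ## (\<not> a) ## tm_smorph s"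
  by (simp add: tm_smorph_def smorph_def tm_letter_def)

lemma snth_tm_smorph: "tm_smorph s !! n = (s !! (n div 2) \<noteq> odd n)"
proof (induction n arbitrary: s rule: less_induct)
  case (less n)
  obtain a r where s: "s = a ## r" by (cases s)
  consider "n = 0" | "n = 1" | m where "n = Suc (Suc m)"
    by (cases n; cases "n - 1") auto
  then show ?case
  proof cases
    case 3
    then show ?thesis using less[of m r] by (simp add: s tm_smorph_SCons)
  qed (auto simp: s tm_smorph_SCons)
qed

fun tm_nth :: "nat \<Rightarrow> bool" where
  "tm_nth n = (if n = 0 then False else tm_nth (n div 2) \<noteq> odd n)"

declare tm_nth.simps [simp del]

lemma thue_morse_ex1: "\<exists>!s. tm_smorph s = s \<and> shd s = False"
proof (rule ex1I)
  show "tm_smorph (smap tm_nth nats) = smap tm_nth nats \<and> shd (smap tm_nth nats) = False"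
  proof
    show "tm_smorph (smap tm_nth nats) = smap tm_nth nats"
    proof (subst stream_snth_eq, intro allI)
      fix n show "tm_smorph (smap tm_nth nats) !! n = smap tm_nth nats !! n"
        unfolding snth_tm_smorph
        by (cases "n = 0") (simp_all add: tm_nth.simps[of n] tm_nth.simps[of 0])
    qed
  qed (simp add: tm_nth.simps)
next
  fix s assume s: "tm_smorph s = s \<and> shd s = False"
  have "s !! n = tm_nth n" for n
  proof (induction n rule: less_induct)
    case (less n)
    show ?case
    proof (cases "n = 0")
      case True
      then show ?thesis using s by (simp add: tm_nth.simps)
    next
      case False
      then have "s !! n = (s !! (n div 2) \<noteq> odd n)"
        using s snth_tm_smorph by metis
      then show ?thesis using less[of "n div 2"] False by (simp add: tm_nth.simps[of n])
    qed
  qed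
  then show "s = smap tm_nth nats" by (auto simp: stream_snth_eq)
qed

lemma thue_morse_fixpoint: "tm_smorph thue_morse = thue_morse" "shd thue_morse = False"
  using theI'[OF thue_morse_ex1] unfolding thue_morse_def by auto

end

theory Submission
  imports Defs "HOL-Computational_Algebra.Polynomial"
begin

text \<open>
  Encode a binary word by the polynomial \<open>\<Sum> \<plusminus> (1 + Y)\<^sup>p\<close> over its positions p, the sign being
  given by the letter at p. Binomial equivalence of order j implies congruence of these
  polynomials modulo \<open>Y\<^sup>j\<close>; the morphism turns a polynomial f into \<open>- Y f(2 Y + Y\<^sup>2)\<close>, so it
  shifts the congruence by exactly one order. On factors of a k-fold image both relations of order
  k + 1 therefore coincide, and comparing constant and linear coefficients shows that the offset
  and the boundary letters of a factor are determined by its class, except that an alternating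
  word can be read at two offsets. Hence, apart from this exception, the number of classes of
  order k + 1 of length \<open>2\<^sup>k n\<close> of the k-fold image of y is \<open>N + (2\<^sup>k - 1) T\<close>, where N counts the
  balances of the factors w of length n of y, and T the triples of the first letter of w, the
  balance of w and the letter that follows w. For the Thue--Morse word T = 6, and N is 3 or 2
  according to the parity of n.

  If y is recurrent, the balance of a window sliding along y moves up and down between any two
  consecutive values, so \<open>T \<ge> 2 (N - 1)\<close>. For k = 0 the count is N itself, and for k at least 2 it
  forces y to have the balances of the Thue--Morse word; for k = 1 factors of odd length of the
  image are used instead. Then factors of y of odd length have balance 1 or -1, so the walk with
  steps 1 and -1 along y is constant on the positions of one parity, which means that y is an
  image under the morphism up to its first letter. A recurrent word can be extended to the left
  without losing recurrence or gaining factors, so that this first letter can be absorbed as well,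
  and the desubstitution can be iterated.
\<close>

lemma nat_parity_cases:
  fixes n :: nat
  obtains (even) h where "n = 2 * h" | (odd) h where "n = Suc (2 * h)"
  by (metis Suc_eq_plus1 evenE oddE)

subsection \<open>Counting scattered subwords\<close>

lemma subword_count_Nil_right [simp]: "subword_count u [] = 1"
proof -
  have "I = {}" if "I \<subseteq> {..<length u}" "nths u I = []" for I
    using that set_nths[of u I] by (auto simp: subset_iff)
  then have "{I. I \<subseteq> {..<length u} \<and> nths u I = []} = {{}}" by auto
  then show ?thesis by (simp add: subword_count_def)
qed

lemma subword_count_Nil_Cons [simp]: "subword_count [] (b # x) = 0"
  by (simp add: subword_count_def)

lemma nths_Cons_image_Suc:
  "nths (a # u) (Suc ` J) = nths u J" "nths (a # u) (insert 0 (Suc ` J)) = a # nths u J"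
proof -
  have "{j. Suc j \<in> Suc ` J} = J" by auto
  then show "nths (a # u) (Suc ` J) = nths u J" "nths (a # u) (insert 0 (Suc ` J)) = a # nths u J"
    by (simp_all add: nths_Cons)
qed

lemma inj_insert_0_image_Suc: "inj (\<lambda>J. insert 0 (Suc ` J))"
proof (rule injI)
  fix I J :: "nat set" assume "insert 0 (Suc ` I) = insert 0 (Suc ` J)"
  then have "Suc ` I = Suc ` J" by (rule insert_ident[THEN iffD1, rotated 2]) auto
  then show "I = J" by (simp add: inj_image_eq_iff)
qed

lemma subword_count_Cons_Cons [simp]:
  "subword_count (a # u) (b # x) =
     subword_count u (b # x) + (if a = b then subword_count u x else 0)"
proof -
  define S where "S = Pow {..<length u}"
  let ?without = "image Suc" and ?with = "\<lambda>J. insert 0 (Suc ` J)"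
  have fin: "finite S" by (simp add: S_def)
  have positions: "Pow {..<length (a # u)} = ?without ` S \<union> ?with ` S"
    by (simp add: S_def lessThan_Suc_eq_insert_0 Pow_insert image_image
        image_Pow_surj[OF refl, symmetric])
  have "{I. I \<subseteq> {..<length (a # u)} \<and> nths (a # u) I = b # x} =
      {I \<in> ?without ` S \<union> ?with ` S. nths (a # u) I = b # x}"
    by (simp only: positions Pow_iff[symmetric])
  also have "\<dots> = ?without ` {J \<in> S. nths (a # u) (?without J) = b # x} \<union>
      ?with ` {J \<in> S. nths (a # u) (?with J) = b # x}"
    by blast
  finally have split: "{I. I \<subseteq> {..<length (a # u)} \<and> nths (a # u) I = b # x} =
      ?without ` {J \<in> S. nths u J = b # x} \<union> ?with ` {J \<in> S. a = b \<and> nths u J = x}"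
    by (simp only: nths_Cons_image_Suc list.inject)
  have "inj ?without" by (simp add: inj_def inj_image_eq_iff)
  moreover have "?without ` {J \<in> S. nths u J = b # x} \<inter> ?with ` {J \<in> S. a = b \<and> nths u J = x} = {}"
    by auto
  ultimately have "subword_count (a # u) (b # x) =
      card {J \<in> S. nths u J = b # x} + card {J \<in> S. a = b \<and> nths u J = x}"
    unfolding subword_count_def split using fin inj_insert_0_image_Suc
    by (simp add: card_Un_disjoint card_image inj_on_subset[OF _ subset_UNIV])
  then show ?thesis by (simp add: subword_count_def S_def)
qed

lemma subword_count_snoc_snoc:
  "subword_count (u @ [a]) (x @ [b]) =
     subword_count u (x @ [b]) + (if a = b then subword_count u x else 0)"
proof (induction u arbitrary: x)
  case Nil
  show ?case by (cases x; cases "tl x") auto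
next
  case (Cons c u)
  show ?case
  proof (cases x)
    case Nil
    then show ?thesis using Cons.IH[of "[]"] by auto
  next
    case (Cons d x')
    show ?thesis using Cons.IH[of x] Cons.IH[of x'] by (auto simp: Cons)
  qed
qed

lemma binom_equiv_refl [simp]: "binom_equiv j u u"
  by (simp add: binom_equiv_def)

lemma binom_equiv_Cons:
  assumes "binom_equiv j u v"
  shows "binom_equiv j (a # u) (a # v)"
  unfolding binom_equiv_def
proof (intro allI impI)
  fix x :: "'a list" assume "length x \<le> j"
  then show "subword_count (a # u) x = subword_count (a # v) x"
    using assms by (cases x) (auto simp: binom_equiv_def)
qed

lemma binom_equiv_snoc:
  assumes "binom_equiv j u v"
  shows "binom_equiv j (u @ [a]) (v @ [a])"
  unfolding binom_equiv_def
proof (intro allI impI)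
  fix x :: "'a list" assume "length x \<le> j"
  then show "subword_count (u @ [a]) x = subword_count (v @ [a]) x"
    using assms by (cases x rule: rev_cases) (auto simp: binom_equiv_def subword_count_snoc_snoc)
qed

lemma binom_equiv_append:
  assumes "binom_equiv j u v"
  shows "binom_equiv j (p @ u @ q) (p @ v @ q)"
proof -
  have "binom_equiv j (u @ q) (v @ q)"
    by (induction q rule: rev_induct) (simp_all add: assms binom_equiv_snoc flip: append_assoc)
  then show ?thesis by (induction p) (simp_all add: binom_equiv_Cons)
qed

lemma finite_words_of_length [simp]: "finite {w :: 'a::finite list. length w = r}"
  using finite_lists_length_eq[OF finite_UNIV, of r] by simp

lemma sum_words_Suc:
  "(\<Sum>w | length w = Suc r. f w) = (\<Sum>a\<in>UNIV. \<Sum>w | length w = r. f (a # w))"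
  for f :: "'a::finite list \<Rightarrow> 'b::comm_monoid_add"
proof -
  let ?cons = "\<lambda>(a, w). a # w" and ?W = "{w :: 'a list. length w = r}"
  have "{w :: 'a list. length w = Suc r} = ?cons ` (UNIV \<times> ?W)"
    by (auto simp: length_Suc_conv)
  moreover have "inj_on ?cons (UNIV \<times> ?W)" by (auto intro: inj_onI)
  ultimately have "(\<Sum>w | length w = Suc r. f w) = (\<Sum>p\<in>UNIV \<times> ?W. f (?cons p))"
    by (simp only: sum.reindex o_def)
  then show ?thesis by (simp add: sum.cartesian_product split_def)
qed

lemma sum_subword_count:
  "(\<Sum>w | length w = r. subword_count u w) = length u choose r" for u :: "'a::finite list"
proof (induction u arbitrary: r)
  case Nil
  show ?case by (cases r) (simp_all add: sum_words_Suc)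
next
  case (Cons a u)
  show ?case
  proof (cases r)
    case (Suc r')
    have delta: "(\<Sum>w | length w = r'. if a = b then subword_count u w else 0) =
        (if a = b then \<Sum>w | length w = r'. subword_count u w else 0)" for b
      by simp
    have "(\<Sum>w | length w = r. subword_count (a # u) w) =
        (\<Sum>w | length w = r. subword_count u w) + (\<Sum>w | length w = r'. subword_count u w)"
      by (simp add: Suc sum_words_Suc sum.distrib delta)
    then show ?thesis by (simp add: Cons.IH Suc)
  qed simp
qed

lemma binom_equiv_imp_length_eq:
  fixes u v :: "'a::finite list"
  assumes "binom_equiv j u v" "j \<ge> 1"
  shows "length u = length v"
proof -
  have "(\<Sum>w | length w = 1. subword_count u w) = (\<Sum>w | length w = 1. subword_count v w)"
    by (rule sum.cong) (use assms in \<open>simp_all add: binom_equiv_def\<close>)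
  then show ?thesis by (simp add: sum_subword_count)
qed

lemma tm_morph_Nil [simp]: "tm_morph [] = []"
  by (simp add: tm_morph_def morph_def)

lemma tm_morph_Cons [simp]: "tm_morph (a # u) = a # (\<not> a) # tm_morph u"
  by (simp add: tm_morph_def morph_def tm_letter_def)

lemma length_tm_morph [simp]: "length (tm_morph u) = 2 * length u"
  by (induction u) auto

lemma tm_morph_eq_iff: "tm_morph u = tm_morph v \<longleftrightarrow> u = v"
proof (induction u arbitrary: v)
  case Nil
  show ?case by (cases v) auto
next
  case (Cons a u)
  then show ?case by (cases v) auto
qed

text \<open>An occurrence of x in the image of u uses one or both letters of the image of each letter
  of u it meets. A letter of u that contributes a single letter is arbitrary, since both images
  contain each letter exactly once; one that contributes two is determined.\<close>

fun preimages :: "bool list \<Rightarrow> bool list list" where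
  "preimages [] = [[]]"
| "preimages [b] = [[False], [True]]"
| "preimages (b # c # x) =
     map ((#) False) (preimages (c # x)) @ map ((#) True) (preimages (c # x)) @
     (if b \<noteq> c then map ((#) b) (preimages x) else [])"

lemma subword_count_tm_morph:
  "subword_count (tm_morph u) x = (\<Sum>e\<leftarrow>preimages x. subword_count u e)"
proof (induction u arbitrary: x)
  case Nil
  have "[] \<notin> set (preimages x)" if "x \<noteq> []"
    using that by (cases x rule: preimages.cases) auto
  then have "\<forall>e\<in>set (preimages x). subword_count [] e = 0" if "x \<noteq> []"
    using that by (metis list.exhaust subword_count_Nil_Cons)
  then show ?case by (cases x) (auto simp: sum_list_eq_0_iff)
next
  case (Cons a u)
  consider "x = []" | b where "x = [b]" | b c y where "x = b # c # y"
    by (metis list.exhaust)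
  then show ?case
  proof cases
    case (3 b c y)
    have "(\<Sum>e\<leftarrow>preimages x. subword_count (a # u) e) =
        (\<Sum>e\<leftarrow>preimages x. subword_count u e) + (\<Sum>e\<leftarrow>preimages (c # y). subword_count u e) +
        (if b \<noteq> c \<and> a = b then \<Sum>e\<leftarrow>preimages y. subword_count u e else 0)"
      by (cases a) (simp_all add: 3 o_def sum_list_addf)
    then show ?thesis unfolding Cons.IH[symmetric] by (auto simp: 3)
  qed (use Cons.IH in auto)
qed

lemma sum_preimages_eq_0:
  fixes f :: "bool list \<Rightarrow> int"
  assumes "\<And>e. length e \<le> length x \<Longrightarrow> f e = 0"
  shows "(\<Sum>e\<leftarrow>preimages x. f e) = 0"
  using assms by (induction x arbitrary: f rule: preimages.induct) (auto simp: o_def)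

lemma sum_preimages_eq_sum_words:
  fixes f :: "bool list \<Rightarrow> int"
  assumes "\<And>e. length e < length x \<Longrightarrow> f e = 0"
  shows "(\<Sum>e\<leftarrow>preimages x. f e) = (\<Sum>e | length e = length x. f e)"
  using assms
proof (induction x arbitrary: f rule: preimages.induct)
  case (3 b c x)
  have "(\<Sum>e\<leftarrow>preimages x. f (d # e)) = 0" for d
    by (rule sum_preimages_eq_0) (use "3.prems" in auto)
  then show ?case
    using "3.IH"(1)[of "\<lambda>e. f (False # e)"] "3.IH"(2)[of "\<lambda>e. f (True # e)"] "3.prems"
    by (simp add: sum_words_Suc UNIV_bool o_def)
qed (simp_all add: sum_words_Suc UNIV_bool)

lemma binom_equiv_tm_morph:
  assumes "binom_equiv j u v" "length u = length v"
  shows "binom_equiv (Suc j) (tm_morph u) (tm_morph v)"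
  unfolding binom_equiv_def
proof (intro allI impI)
  fix x :: "bool list" assume x: "length x \<le> Suc j"
  let ?f = "\<lambda>e. int (subword_count u e) - int (subword_count v e)"
  have "int (\<Sum>e\<leftarrow>es. g e) = (\<Sum>e\<leftarrow>es. int (g e))" for g :: "bool list \<Rightarrow> nat" and es
    by (induction es) auto
  then have "int (subword_count (tm_morph u) x) - int (subword_count (tm_morph v) x) =
      (\<Sum>e\<leftarrow>preimages x. ?f e)"
    by (simp only: subword_count_tm_morph sum_list_subtractf)
  also have "\<dots> = (\<Sum>e | length e = length x. ?f e)"
    by (rule sum_preimages_eq_sum_words) (use assms x in \<open>simp add: binom_equiv_def\<close>)
  also have "\<dots> = 0"
    by (simp add: sum_subtractf sum_subword_count assms flip: of_nat_sum)
  finally show "subword_count (tm_morph u) x = subword_count (tm_morph v) x" by simp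
qed

subsection \<open>Moments of binary words\<close>

definition letter_sign :: "bool \<Rightarrow> int" where
  "letter_sign a = (if a then 1 else - 1)"

lemma letter_sign_simps [simp]:
  "letter_sign True = 1" "letter_sign False = - 1" "letter_sign (\<not> a) = - letter_sign a"
  by (auto simp: letter_sign_def)

lemma letter_sign_eq_iff [simp]: "letter_sign a = letter_sign b \<longleftrightarrow> a = b"
  by (auto simp: letter_sign_def)

primrec balance :: "bool list \<Rightarrow> int" where
  "balance [] = 0"
| "balance (a # u) = letter_sign a + balance u"

lemma balance_append [simp]: "balance (u @ v) = balance u + balance v"
  by (induction u) auto

lemma balance_tm_morph [simp]: "balance (tm_morph u) = 0"
  by (induction u) auto

lemma balance_le_length: "letter_sign c * balance u \<le> int (length u)"
  by (induction u) (auto simp: letter_sign_def)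

lemma balance_eq_length_imp_replicate:
  assumes "letter_sign c * balance u = int (length u)"
  shows "u = replicate (length u) c"
  using assms
proof (induction u)
  case (Cons a u)
  then show ?case using balance_le_length[of c u] by (cases a; cases c) auto
qed simp

lemma even_balance_diff_length: "even (balance u - int (length u))"
  by (induction u) (auto simp: letter_sign_def)

text \<open>The coefficient of degree i is the sum of \<open>\<plusminus> (p choose i)\<close> over all positions p, the sign
  being given by the letter at p.\<close>

primrec word_poly :: "bool list \<Rightarrow> int poly" where
  "word_poly [] = 0"
| "word_poly (a # u) = [:letter_sign a:] + [:1, 1:] * word_poly u"

definition moments :: "nat \<Rightarrow> bool list \<Rightarrow> int poly" where
  "moments j w = poly_cutoff j (word_poly w)"

definition moment_equiv :: "nat \<Rightarrow> bool list \<Rightarrow> bool list \<Rightarrow> bool" where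
  "moment_equiv j u v \<longleftrightarrow> length u = length v \<and> moments j u = moments j v"

lemma moments_eq_iff_coeff:
  "moments j u = moments j v \<longleftrightarrow> (\<forall>i<j. coeff (word_poly u) i = coeff (word_poly v) i)"
  by (auto simp: moments_def poly_eq_iff coeff_poly_cutoff)

lemma moment_equiv_iff_dvd:
  "moment_equiv j u v \<longleftrightarrow> length u = length v \<and> monom 1 j dvd word_poly u - word_poly v"
  by (simp add: moment_equiv_def moments_eq_iff_coeff monom_1_dvd_iff')

lemma moment_equiv_sym: "moment_equiv j u v \<Longrightarrow> moment_equiv j v u"
  by (simp add: moment_equiv_def)

lemma moment_equiv_mono: "moment_equiv j u v \<Longrightarrow> i \<le> j \<Longrightarrow> moment_equiv i u v"
  by (auto simp: moment_equiv_def moments_eq_iff_coeff)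

lemma coeff_word_poly:
  "coeff (word_poly u) i =
     (\<Sum>e | length e = i. int (subword_count u (e @ [True])) - int (subword_count u (e @ [False])))"
proof (induction u arbitrary: i)
  case Nil
  have "subword_count [] (e @ [a]) = 0" for e :: "bool list" and a by (cases e) auto
  then show ?case by simp
next
  case (Cons a u)
  show ?case
  proof (cases i)
    case 0
    then show ?thesis using Cons.IH[of 0] by (cases a) auto
  next
    case (Suc i')
    then show ?thesis
      using Cons.IH[of i] Cons.IH[of i']
      by (cases a) (simp_all add: coeff_pCons sum_words_Suc UNIV_bool sum.distrib sum_subtractf)
  qed
qed

lemma binom_equiv_imp_moment_equiv:
  assumes "binom_equiv j u v" "j \<ge> 1"
  shows "moment_equiv j u v"
  unfolding moment_equiv_def moments_eq_iff_coeff coeff_word_poly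
  using assms binom_equiv_imp_length_eq[OF assms] by (auto intro!: sum.cong simp: binom_equiv_def)

lemma moment_equiv_1_imp_binom_equiv:
  assumes "moment_equiv 1 u v"
  shows "binom_equiv 1 u v"
proof -
  have "subword_count u [False] + subword_count u [True] =
      subword_count v [False] + subword_count v [True]"
    using sum_subword_count[where r = 1 and u = u] sum_subword_count[where r = 1 and u = v] assms
    by (simp add: moment_equiv_def sum_words_Suc UNIV_bool)
  moreover have "int (subword_count u [True]) - int (subword_count u [False]) =
      int (subword_count v [True]) - int (subword_count v [False])"
    using assms coeff_word_poly[of _ 0] by (simp add: moment_equiv_def moments_eq_iff_coeff)
  ultimately have "subword_count u [a] = subword_count v [a]" for a by (cases a) auto
  then show ?thesis by (auto simp: binom_equiv_def le_Suc_eq length_Suc_conv)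
qed

lemma monom_1_Suc_dvd_pCons: "monom 1 (Suc j) dvd pCons c p \<longleftrightarrow> c = 0 \<and> monom 1 j dvd p"
  by (auto simp: monom_1_dvd_iff' coeff_pCons All_less_Suc2)

lemma monom_1_dvd_mult_iff:
  fixes p q :: "'a::idom poly"
  assumes "coeff q 0 \<noteq> 0"
  shows "monom 1 j dvd q * p \<longleftrightarrow> monom 1 j dvd p"
proof (induction j arbitrary: p)
  case (Suc j)
  obtain c p' where p: "p = pCons c p'" by (cases p)
  obtain d q' where q: "q = pCons d q'" by (cases q)
  have "q * p = pCons (d * c) (smult c q' + q * p')"
    by (simp add: p q algebra_simps)
  then show ?case using assms Suc.IH[of p'] by (auto simp: p q monom_1_Suc_dvd_pCons)
qed simp

lemma monom_1_dvd_pcompose_iff: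
  fixes p q :: "'a::idom poly"
  assumes "coeff q 0 \<noteq> 0"
  shows "monom 1 j dvd p \<circ>\<^sub>p pCons 0 q \<longleftrightarrow> monom 1 j dvd p"
proof (induction j arbitrary: p)
  case (Suc j)
  obtain c p' where p: "p = pCons c p'" by (cases p)
  have "p \<circ>\<^sub>p pCons 0 q = pCons c (q * (p' \<circ>\<^sub>p pCons 0 q))"
    by (simp add: p pcompose_pCons)
  then show ?case using Suc.IH[of p']
    by (simp add: p monom_1_Suc_dvd_pCons monom_1_dvd_mult_iff[OF assms])
qed simp

lemma word_poly_append: "word_poly (u @ v) = word_poly u + [:1, 1:] ^ length u * word_poly v"
  by (induction u) (auto simp: algebra_simps)

lemma moment_equiv_append [simp]:
  "moment_equiv j (p @ u @ q) (p @ v @ q) \<longleftrightarrow> moment_equiv j u v"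
proof (cases "length u = length v")
  case True
  then have "word_poly (p @ u @ q) - word_poly (p @ v @ q) =
      [:1, 1:] ^ length p * (word_poly u - word_poly v)"
    by (simp add: word_poly_append algebra_simps)
  moreover have "coeff ([:1, 1:] ^ length p :: int poly) 0 \<noteq> 0"
    by (simp add: coeff_0_power)
  ultimately show ?thesis
    by (simp add: moment_equiv_iff_dvd monom_1_dvd_mult_iff True)
qed (simp add: moment_equiv_def)

lemma moment_equiv_Cons [simp]: "moment_equiv j (a # u) (a # v) \<longleftrightarrow> moment_equiv j u v"
  using moment_equiv_append[of j "[a]" u "[]" v] by simp

lemma word_poly_tm_morph: "word_poly (tm_morph u) = - pCons 0 (word_poly u \<circ>\<^sub>p [:0, 2, 1:])"
proof (induction u)
  case (Cons a u)
  have "smult 2 p = 2 * p" for p :: "int poly" by (simp add: numeral_poly)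
  then show ?case
    by (simp add: Cons.IH pcompose_add pcompose_mult pcompose_pCons algebra_simps)
qed simp

lemma moment_equiv_tm_morph [simp]:
  "moment_equiv (Suc j) (tm_morph u) (tm_morph v) \<longleftrightarrow> moment_equiv j u v"
proof -
  have "word_poly (tm_morph u) - word_poly (tm_morph v) =
      - pCons 0 ((word_poly u - word_poly v) \<circ>\<^sub>p [:0, 2, 1:])"
    by (simp add: word_poly_tm_morph pcompose_diff)
  then show ?thesis
    by (simp only: moment_equiv_iff_dvd dvd_minus_iff monom_1_Suc_dvd_pCons)
      (simp add: monom_1_dvd_pcompose_iff)
qed

definition linear_coeff :: "bool list \<Rightarrow> int" where
  "linear_coeff u = coeff (word_poly u) 1"

lemma coeff_0_word_poly: "coeff (word_poly u) 0 = balance u"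
  by (induction u) auto

lemma linear_coeff_simps [simp]:
  "linear_coeff [] = 0" "linear_coeff (a # u) = linear_coeff u + balance u"
  by (simp_all add: linear_coeff_def coeff_pCons coeff_0_word_poly)

lemma linear_coeff_append:
  "linear_coeff (u @ v) = linear_coeff u + linear_coeff v + int (length u) * balance v"
  by (induction u) (auto simp: algebra_simps)

lemma linear_coeff_tm_morph: "linear_coeff (tm_morph u) = - balance u"
  by (induction u) auto

lemma moments_1: "moments (Suc 0) w = [:balance w:]"
  by (simp add: moments_def poly_eq_iff coeff_poly_cutoff coeff_pCons coeff_0_word_poly
      split: nat.split)

lemma moments_2: "moments 2 w = [:balance w, linear_coeff w:]"
  by (auto simp: moments_def poly_eq_iff coeff_poly_cutoff coeff_pCons coeff_0_word_poly
      linear_coeff_def split: nat.split)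

lemma moment_equiv_2_iff:
  "moment_equiv 2 u v \<longleftrightarrow>
     length u = length v \<and> balance u = balance v \<and> linear_coeff u = linear_coeff v"
  by (simp add: moment_equiv_def moments_2)

subsection \<open>Words cut out of images\<close>

lemma length_le_1_iff: "length p \<le> 1 \<longleftrightarrow> p = [] \<or> (\<exists>a. p = [a])"
  by (cases p) auto

lemma tm_morph_replicate_snoc:
  "tm_morph (replicate n c) @ [c] = c # tm_morph (replicate n (\<not> c))"
  by (induction n) auto

lemma moment_equiv_2_tm_morph_offset:
  assumes "moment_equiv 2 (tm_morph u) (a # tm_morph v @ [b])"
  obtains n where "a = (\<not> b)" "u = replicate (Suc n) (\<not> b)" "v = replicate n b"
proof
  have len: "length u = Suc (length v)" and sign: "letter_sign a = - letter_sign b"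
    and lin: "- balance u = - balance v + int (2 * length v + 1) * letter_sign b"
    using assms
    by (auto simp: moment_equiv_2_iff linear_coeff_append linear_coeff_tm_morph algebra_simps)
  show "a = (\<not> b)" using sign by (auto simp: letter_sign_def split: if_splits)
  have "letter_sign (\<not> b) * balance u = int (length u)" "letter_sign b * balance v = int (length v)"
    using lin len balance_le_length[of "\<not> b" u] balance_le_length[of b v] by (cases b; simp)+
  then show "u = replicate (Suc (length v)) (\<not> b)" "v = replicate (length v) b"
    using balance_eq_length_imp_replicate len by metis+
qed

lemma moment_equiv_2_snoc_Cons:
  assumes "moment_equiv 2 (tm_morph u @ [b]) (a # tm_morph v)"
  obtains n where "a = b" "u = replicate n b" "v = replicate n (\<not> b)"
proof
  have len: "length u = length v" and ab: "a = b"
    and lin: "- balance u + int (2 * length u) * letter_sign b = - balance v"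
    using assms by (auto simp: moment_equiv_2_iff linear_coeff_append linear_coeff_tm_morph)
  show "a = b" by (rule ab)
  have "letter_sign b * balance u = int (length u)" "letter_sign (\<not> b) * balance v = int (length v)"
    using lin len balance_le_length[of b u] balance_le_length[of "\<not> b" v] by (cases b; simp)+
  then show "u = replicate (length v) b" "v = replicate (length v) (\<not> b)"
    using balance_eq_length_imp_replicate len by metis+
qed

lemma moment_equiv_2_ends:
  assumes "moment_equiv 2 (a # tm_morph u @ [b]) (a' # tm_morph u' @ [b'])"
  shows "a = a'" "b = b'"
proof -
  have len: "length u = length u'"
    and sign: "letter_sign a + letter_sign b = letter_sign a' + letter_sign b'"
    and lin: "- balance u + int (2 * length u + 1) * letter_sign b =
      - balance u' + int (2 * length u' + 1) * letter_sign b'"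
    using assms
    by (auto simp: moment_equiv_2_iff linear_coeff_append linear_coeff_tm_morph algebra_simps)
  show "b = b'"
    using lin len balance_le_length[of True u] balance_le_length[of False u]
      balance_le_length[of True u'] balance_le_length[of False u'] by (cases b; cases b'; simp)
  then show "a = a'" using sign by simp
qed

lemma moment_equiv_2_same_offset:
  assumes "moment_equiv 2 (p @ tm_morph u @ q) (p' @ tm_morph u' @ q')"
    and "length p = length p'" "length p \<le> 1" "length q \<le> 1" "length q' \<le> 1"
  shows "p = p' \<and> q = q'"
proof -
  have "length q + 2 * length u = length q' + 2 * length u'"
    using assms(1,2) by (simp add: moment_equiv_def)
  then have "length q = length q'" using assms(4,5) by presburger
  moreover have "r = [] \<and> r' = [] \<or> (\<exists>a a'. r = [a] \<and> r' = [a'])"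
    if "length r = length r'" "length r \<le> 1" for r r' :: "bool list"
    using that by (cases r; cases r') auto
  ultimately have ends: "p = [] \<and> p' = [] \<or> (\<exists>a a'. p = [a] \<and> p' = [a'])"
    "q = [] \<and> q' = [] \<or> (\<exists>b b'. q = [b] \<and> q' = [b'])"
    using assms(2-4) by simp_all
  have "balance (p @ tm_morph u @ q) = balance (p' @ tm_morph u' @ q')"
    using assms(1) by (simp only: moment_equiv_2_iff)
  then show ?thesis
    using ends assms(1) moment_equiv_2_ends by (elim disjE exE conjE) simp_all
qed

lemma moment_equiv_2_distinct_offset:
  assumes "moment_equiv 2 (tm_morph u @ q) (a # tm_morph u' @ q')" "length q \<le> 1" "length q' \<le> 1"
  shows "tm_morph u @ q = a # tm_morph u' @ q'"
proof -
  have len: "length q + 2 * length u = Suc (length q' + 2 * length u')"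
    using assms(1) by (simp add: moment_equiv_def)
  then have "even (length q + Suc (length q'))" by presburger
  then consider b where "q = []" "q' = [b]" | b where "q = [b]" "q' = []"
    using assms(2,3) unfolding length_le_1_iff by fastforce
  then show ?thesis
  proof cases
    case (1 b)
    then have "moment_equiv 2 (tm_morph u) (a # tm_morph u' @ [b])" using assms(1) by simp
    then obtain n where "a = (\<not> b)" "u = replicate (Suc n) (\<not> b)" "u' = replicate n b"
      by (rule moment_equiv_2_tm_morph_offset)
    then show ?thesis using tm_morph_replicate_snoc[of n b] by (simp add: 1)
  next
    case (2 b)
    then have "moment_equiv 2 (tm_morph u @ [b]) (a # tm_morph u')" using assms(1) by simp
    then obtain n where "a = b" "u = replicate n b" "u' = replicate n (\<not> b)"
      by (rule moment_equiv_2_snoc_Cons)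
    then show ?thesis using tm_morph_replicate_snoc[of n b] by (simp add: 2)
  qed
qed

text \<open>Words that are read at different offsets and agree in their first two moments are
  alternating.\<close>

lemma moment_equiv_2_cut_images:
  assumes "moment_equiv 2 (p @ tm_morph u @ q) (p' @ tm_morph u' @ q')"
    and short: "length p \<le> 1" "length q \<le> 1" "length p' \<le> 1" "length q' \<le> 1"
  shows "p = p' \<and> q = q' \<or> p @ tm_morph u @ q = p' @ tm_morph u' @ q'"
proof -
  consider "length p = length p'" | a where "p = []" "p' = [a]" | a where "p = [a]" "p' = []"
    using short(1,3) unfolding length_le_1_iff by fastforce
  then show ?thesis
  proof cases
    case 1
    then show ?thesis using moment_equiv_2_same_offset[OF assms(1)] short by blast
  next
    case (2 a)
    then show ?thesis using moment_equiv_2_distinct_offset[of u q a u' q'] assms(1) short by simp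
  next
    case (3 a)
    then show ?thesis
      using moment_equiv_2_distinct_offset[of u' q' a u q] moment_equiv_sym[OF assms(1)] short
      by simp
  qed
qed

subsection \<open>Factors of images\<close>

definition tails :: "'a stream \<Rightarrow> 'a stream set" where
  "tails s = range (\<lambda>i. sdrop i s)"

lemma sdrop_in_tails [simp]: "sdrop i s \<in> tails s"
  by (simp add: tails_def)

lemma stl_in_tails: "r \<in> tails s \<Longrightarrow> stl r \<in> tails s"
  by (auto simp: tails_def simp flip: sdrop.simps(2) sdrop_stl)

lemma factors_eq_UN: "factors s = (\<Union>n. stake n ` tails s)"
proof (intro equalityI subsetI)
  fix w assume "w \<in> factors s"
  then obtain i where "stake (length w) (sdrop i s) = w" by (auto simp: factors_def occurs_at_def)
  then show "w \<in> (\<Union>n. stake n ` tails s)" by (metis UN_I UNIV_I imageI sdrop_in_tails)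
qed (auto simp: tails_def factors_def occurs_at_def)

lemma stake_in_factors: "r \<in> tails s \<Longrightarrow> stake n r \<in> factors s"
  by (auto simp: factors_eq_UN)

lemma factors_of_length: "{w \<in> factors s. length w = n} = stake n ` tails s"
  by (auto simp: factors_eq_UN)

lemma factorsE:
  assumes "w \<in> factors s"
  obtains r where "r \<in> tails s" "w = stake (length w) r"
  using assms by (auto simp: factors_eq_UN)

lemma tm_smorph_unfold: "tm_smorph r = shd r ## (\<not> shd r) ## tm_smorph (stl r)"
  using tm_smorph_SCons[of "shd r" "stl r"] by simp

lemma sdrop_tm_smorph: "sdrop (2 * i) (tm_smorph s) = tm_smorph (sdrop i s)"
proof (induction i arbitrary: s)
  case (Suc i)
  then show ?case by (subst tm_smorph_unfold) simp
qed simp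

lemma tails_tm_smorph:
  "tails (tm_smorph s) = tm_smorph ` tails s \<union> (\<lambda>r. stl (tm_smorph r)) ` tails s"
proof -
  have "sdrop i (tm_smorph s) \<in> tm_smorph ` tails s \<union> (\<lambda>r. stl (tm_smorph r)) ` tails s" for i
    by (cases i rule: nat_parity_cases) (auto simp: sdrop_tm_smorph sdrop_stl)
  moreover have "tm_smorph (sdrop i s) \<in> tails (tm_smorph s)" for i
    by (simp flip: sdrop_tm_smorph)
  ultimately show ?thesis by (auto simp: tails_def stl_in_tails[unfolded tails_def])
qed

lemma stake_tm_smorph: "stake (2 * n) (tm_smorph r) = tm_morph (stake n r)"
proof (induction n arbitrary: r)
  case (Suc n)
  then show ?case by (subst tm_smorph_unfold) simp
qed simp

lemma snth_tm_smorph_double [simp]: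
  "tm_smorph r !! (2 * n) = r !! n" "stl (tm_smorph r) !! (2 * n) = (\<not> r !! n)"
  using snth_tm_smorph[of r "2 * n"] snth_tm_smorph[of r "Suc (2 * n)"] by simp_all

lemma stake_Suc_tm_smorph: "stake (Suc (2 * n)) (tm_smorph r) = tm_morph (stake n r) @ [r !! n]"
  by (simp add: stake_Suc stake_tm_smorph del: stake.simps)

lemma stl_tm_smorph: "stl (tm_smorph r) = (\<not> shd r) ## tm_smorph (stl r)"
  by (subst tm_smorph_unfold) simp

lemma shd_tm_smorph [simp]: "shd (tm_smorph r) = shd r" "shd (stl (tm_smorph r)) = (\<not> shd r)"
  by (subst tm_smorph_unfold, simp)+

lemma stake_stl_tm_smorph:
  "stake (Suc (2 * n)) (stl (tm_smorph r)) = (\<not> shd r) # tm_morph (stake n (stl r))"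
  by (simp add: stl_tm_smorph stake_tm_smorph)

lemma stake_Suc_stl_tm_smorph:
  "stake (2 * Suc n) (stl (tm_smorph r)) = (\<not> shd r) # tm_morph (stake n (stl r)) @ [r !! Suc n]"
  using stake_Suc_tm_smorph[of n "stl r"] by (simp add: stl_tm_smorph)

lemma stake_tm_smorph_cases:
  obtains q where "stake n (tm_smorph r) = tm_morph (stake (n div 2) r) @ q" "length q \<le> 1"
proof (cases n rule: nat_parity_cases)
  case (even h)
  then show ?thesis using that[of "[]"] by (simp add: stake_tm_smorph)
next
  case (odd h)
  then show ?thesis using that[of "[r !! h]"] stake_Suc_tm_smorph[of h r] by simp
qed

lemma factors_tm_smorphE:
  assumes "w \<in> factors (tm_smorph s)"
  obtains p u q where "w = p @ tm_morph u @ q" "u \<in> factors s" "length p \<le> 1" "length q \<le> 1"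
proof -
  obtain r where r: "r \<in> tails (tm_smorph s)" "w = stake (length w) r"
    using assms by (rule factorsE)
  then consider (even_start) t where "t \<in> tails s" "r = tm_smorph t"
    | (odd_start) t where "t \<in> tails s" "r = (\<not> shd t) ## tm_smorph (stl t)"
    by (auto simp: tails_tm_smorph stl_tm_smorph)
  then show ?thesis
  proof cases
    case even_start
    obtain q where "stake (length w) r = tm_morph (stake (length w div 2) t) @ q" "length q \<le> 1"
      unfolding even_start(2) by (rule stake_tm_smorph_cases)
    then show ?thesis
      using that[of "[]" "stake (length w div 2) t" q] r(2) even_start(1)
      by (simp add: stake_in_factors)
  next
    case odd_start
    show ?thesis
    proof (cases "length w")
      case 0
      then show ?thesis
        using that[of "[]" "[]" "[]"] stake_in_factors[OF odd_start(1), of 0] by simp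
    next
      case (Suc n)
      obtain q where q: "stake n (tm_smorph (stl t)) = tm_morph (stake (n div 2) (stl t)) @ q"
        "length q \<le> 1"
        by (rule stake_tm_smorph_cases)
      have "w = (\<not> shd t) # stake n (tm_smorph (stl t))" using r(2) by (simp add: odd_start(2) Suc)
      then show ?thesis
        using that[of "[\<not> shd t]" "stake (n div 2) (stl t)" q] q stl_in_tails[OF odd_start(1)]
        by (simp add: stake_in_factors)
    qed
  qed
qed

lemma moment_equiv_imp_binom_equiv_factors:
  assumes "w \<in> factors ((tm_smorph ^^ K) s)" "w' \<in> factors ((tm_smorph ^^ K) s)"
    and "moment_equiv (Suc K) w w'"
  shows "binom_equiv (Suc K) w w'"
  using assms
proof (induction K arbitrary: w w')
  case 0
  then show ?case using moment_equiv_1_imp_binom_equiv by simp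
next
  case (Suc K)
  obtain p u q where w: "w = p @ tm_morph u @ q" "length p \<le> 1" "length q \<le> 1"
    and u: "u \<in> factors ((tm_smorph ^^ K) s)"
    using Suc.prems(1) by (auto elim: factors_tm_smorphE)
  obtain p' u' q' where w': "w' = p' @ tm_morph u' @ q'" "length p' \<le> 1" "length q' \<le> 1"
    and u': "u' \<in> factors ((tm_smorph ^^ K) s)"
    using Suc.prems(2) by (auto elim: factors_tm_smorphE)
  have "moment_equiv 2 w w'" by (rule moment_equiv_mono[OF Suc.prems(3)]) simp
  then consider "w = w'" | "p = p'" "q = q'"
    using moment_equiv_2_cut_images w w' by blast
  then show ?case
  proof cases
    case 2
    then have equiv: "moment_equiv (Suc K) u u'" using Suc.prems(3) w w' by simp
    then have "binom_equiv (Suc K) u u'" by (rule Suc.IH[OF u u'])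
    then have "binom_equiv (Suc (Suc K)) (tm_morph u) (tm_morph u')"
      by (rule binom_equiv_tm_morph) (use equiv in \<open>simp add: moment_equiv_def\<close>)
    then show ?thesis unfolding w w' 2 by (rule binom_equiv_append)
  qed simp
qed

subsection \<open>Counting classes\<close>

lemma card_image_eq_if_same_fibres:
  assumes "\<And>x y. x \<in> A \<Longrightarrow> y \<in> A \<Longrightarrow> f x = f y \<longleftrightarrow> g x = g y"
  shows "card (f ` A) = card (g ` A)"
proof -
  define h where "h = g \<circ> inv_into A f"
  have h: "h (f x) = g x" if "x \<in> A" for x
    using assms[of "inv_into A f (f x)" x] that by (simp add: h_def f_inv_into_f inv_into_into)
  have "g ` A = h ` f ` A" by (auto simp: h image_image)
  moreover have "inj_on h (f ` A)" using assms by (auto simp: inj_on_def h)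
  ultimately show ?thesis by (simp add: card_image)
qed

lemma finite_image_tails:
  fixes s :: "'a::finite stream"
  assumes "\<And>r r'. stake n r = stake n r' \<Longrightarrow> f r = f r'"
  shows "finite (f ` tails s)"
proof -
  have "stake n ` tails s \<subseteq> {w. length w = n}" by auto
  then have "finite (stake n ` tails s)" by (rule finite_subset) simp
  moreover have "f r = f (stake n r @- s)" for r
    by (rule assms) (simp add: stake_shift)
  then have "f ` tails s = (\<lambda>w. f (w @- s)) ` stake n ` tails s"
    by (simp add: image_image)
  ultimately show ?thesis by simp
qed

definition classes :: "nat \<Rightarrow> bool stream \<Rightarrow> nat \<Rightarrow> int poly set" where
  "classes j s n = (\<lambda>r. moments j (stake n r)) ` tails s"

definition bordered_classes :: "nat \<Rightarrow> bool stream \<Rightarrow> nat \<Rightarrow> (bool \<times> int poly \<times> bool) set" where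
  "bordered_classes j s n = (\<lambda>r. (shd r, moments j (stake n r), r !! n)) ` tails s"

lemma stake_Suc_eq_iff:
  "stake (Suc n) r = stake (Suc n) r' \<longleftrightarrow> stake n r = stake n r' \<and> r !! n = r' !! n"
  by (simp add: stake_Suc del: stake.simps)

lemma finite_classes [simp]: "finite (classes j s n)"
  unfolding classes_def by (rule finite_image_tails[of n]) simp

lemma finite_bordered_classes [simp]: "finite (bordered_classes j s n)"
  unfolding bordered_classes_def
proof (rule finite_image_tails[of "Suc n"])
  fix r r' :: "bool stream" assume eq: "stake (Suc n) r = stake (Suc n) r'"
  then have "shd r = shd r'" by simp
  then show "(shd r, moments j (stake n r), r !! n) = (shd r', moments j (stake n r'), r' !! n)"
    using eq by (simp add: stake_Suc_eq_iff del: stake.simps)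
qed

lemma binom_complexity_funpow_tm_smorph:
  "binom_complexity (Suc K) ((tm_smorph ^^ K) s) n = card (classes (Suc K) ((tm_smorph ^^ K) s) n)"
proof -
  let ?z = "(tm_smorph ^^ K) s" and ?R = "{(u, v). binom_equiv (Suc K) u (v :: bool list)}"
  have "{w \<in> factors ?z. length w = n} // ?R = (\<lambda>r. ?R `` {stake n r}) ` tails ?z"
    unfolding factors_of_length quotient_def by blast
  moreover have "card ((\<lambda>r. ?R `` {stake n r}) ` tails ?z) = card (classes (Suc K) ?z n)"
    unfolding classes_def
  proof (rule card_image_eq_if_same_fibres)
    fix r r' assume tails: "r \<in> tails ?z" "r' \<in> tails ?z"
    have "?R `` {stake n r} = ?R `` {stake n r'} \<longleftrightarrow> binom_equiv (Suc K) (stake n r) (stake n r')"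
      by (auto simp: binom_equiv_def)
    also have "\<dots> \<longleftrightarrow> moment_equiv (Suc K) (stake n r) (stake n r')"
      using binom_equiv_imp_moment_equiv[of "Suc K"] moment_equiv_imp_binom_equiv_factors
        stake_in_factors[OF tails(1)] stake_in_factors[OF tails(2)] by fastforce
    finally show "?R `` {stake n r} = ?R `` {stake n r'} \<longleftrightarrow>
        moments (Suc K) (stake n r) = moments (Suc K) (stake n r')"
      by (simp add: moment_equiv_def)
  qed
  ultimately show ?thesis by (simp add: binom_complexity_def)
qed

text \<open>In an aligned word no alternating factor of length \<open>2n\<close> of the image occurs at offsets of
  both parities.\<close>

definition aligned :: "bool stream \<Rightarrow> nat \<Rightarrow> bool" where
  "aligned s n \<longleftrightarrow> (\<forall>c. replicate n c \<in> factors s \<longrightarrow> replicate (Suc n) (\<not> c) \<notin> factors s)"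

lemma replicate_in_factors_mono:
  assumes "replicate n c \<in> factors s" "m \<le> n"
  shows "replicate m c \<in> factors s"
proof -
  obtain r where r: "r \<in> tails s" "replicate n c = stake n r"
    using factorsE[OF assms(1)] by auto
  have "stake m r = take m (stake n r)" using assms(2) by (simp add: take_stake min_def)
  also have "\<dots> = replicate m c" using assms(2) by (simp add: min_def flip: r(2))
  finally show ?thesis using stake_in_factors[OF r(1)] by metis
qed

lemma aligned_mono: "aligned s m \<Longrightarrow> m \<le> n \<Longrightarrow> aligned s n"
  unfolding aligned_def by (meson Suc_le_mono replicate_in_factors_mono)

lemma cube_notin_factors_tm_smorph: "replicate 3 c \<notin> factors (tm_smorph s)"
proof
  assume "replicate 3 c \<in> factors (tm_smorph s)"
  then obtain r where "r \<in> tails (tm_smorph s)" "replicate 3 c = stake 3 r"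
    by (auto elim: factorsE)
  moreover have "stake 3 (tm_smorph t) = [shd t, \<not> shd t, shd (stl t)]"
    "stake 3 (stl (tm_smorph t)) = [\<not> shd t, shd (stl t), \<not> shd (stl t)]" for t
    using stake_Suc_tm_smorph[of 1 t] stake_stl_tm_smorph[of 1 t] by (simp_all add: numeral_3_eq_3)
  ultimately show False by (auto simp: tails_tm_smorph numeral_3_eq_3 simp del: stake.simps)
qed

lemma aligned_tm_smorph: "n \<ge> 2 \<Longrightarrow> aligned (tm_smorph s) n"
  using cube_notin_factors_tm_smorph replicate_in_factors_mono[of "Suc n" _ "tm_smorph s" 3]
  by (auto simp: aligned_def)

lemma moment_equiv_stake_tm_smorph:
  "moment_equiv (Suc j) (stake (2 * n) (tm_smorph r)) (stake (2 * n) (tm_smorph r')) \<longleftrightarrow>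
     moment_equiv j (stake n r) (stake n r')"
  by (simp add: stake_tm_smorph)

lemma moment_equiv_stake_stl_tm_smorph:
  assumes "n \<ge> 1" "j \<ge> 1"
  shows "moment_equiv (Suc j)
       (stake (2 * n) (stl (tm_smorph r))) (stake (2 * n) (stl (tm_smorph r'))) \<longleftrightarrow>
     shd r = shd r' \<and> moment_equiv j (stake n r) (stake n r') \<and> r !! n = r' !! n"
    (is "?equiv \<longleftrightarrow> _")
proof -
  obtain m where n: "n = Suc m" using assms(1) by (cases n) auto
  have "shd r = shd r' \<and> r !! n = r' !! n" if ?equiv
    using moment_equiv_2_ends[of "\<not> shd r" _ "r !! n"] moment_equiv_mono[OF that, of 2] assms(2)
    unfolding n stake_Suc_stl_tm_smorph by fastforce
  moreover have "?equiv \<longleftrightarrow> moment_equiv j (stake n r) (stake n r')"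
    if "shd r = shd r'" "r !! n = r' !! n"
    using moment_equiv_append[of "Suc j" "[\<not> shd r]" "tm_morph (stake m (stl r))" "[r !! n]"] that
    unfolding n stake_Suc_stl_tm_smorph by simp
  ultimately show ?thesis by blast
qed

lemma aligned_imp_moments_distinct:
  assumes "aligned s n" "n \<ge> 1" "j \<ge> 1" "r \<in> tails s" "r' \<in> tails s"
  shows "moments (Suc j) (stake (2 * n) (tm_smorph r)) \<noteq>
    moments (Suc j) (stake (2 * n) (stl (tm_smorph r')))"
proof
  obtain m where n: "n = Suc m" using assms(2) by (cases n) auto
  assume "moments (Suc j) (stake (2 * n) (tm_smorph r)) =
    moments (Suc j) (stake (2 * n) (stl (tm_smorph r')))"
  then have "moment_equiv (Suc j) (stake (2 * n) (tm_smorph r)) (stake (2 * n) (stl (tm_smorph r')))"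
    by (simp add: moment_equiv_def)
  then have "moment_equiv 2 (stake (2 * n) (tm_smorph r)) (stake (2 * n) (stl (tm_smorph r')))"
    by (rule moment_equiv_mono) (use assms(3) in simp)
  then obtain l where l: "(\<not> shd r') = (\<not> r' !! n)" "stake n r = replicate (Suc l) (\<not> r' !! n)"
    "stake m (stl r') = replicate l (r' !! n)"
    unfolding n stake_tm_smorph stake_Suc_stl_tm_smorph by (rule moment_equiv_2_tm_morph_offset)
  have "l = m" using arg_cong[OF l(3), of length] by simp
  define c where "c = r' !! n"
  have "stake n r = replicate n (\<not> c)" using l(2) by (simp only: c_def n \<open>l = m\<close>)
  moreover have "stake (Suc n) r' = replicate (Suc n) c"
  proof -
    have "stake (Suc n) r' = shd r' # stake m (stl r') @ [r' !! n]"
      using stake_Suc[of m "stl r'"] by (simp add: n)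
    then show ?thesis using l(1,3) by (simp add: c_def n \<open>l = m\<close> replicate_append_same)
  qed
  ultimately show False
    using assms(1)[unfolded aligned_def, rule_format, of "\<not> c"]
      stake_in_factors[OF assms(4), of n] stake_in_factors[OF assms(5), of "Suc n"]
    by (simp only: not_not)
qed

lemma card_Un_images:
  assumes "finite (f ` A \<union> g ` A)" "\<And>x y. x \<in> A \<Longrightarrow> y \<in> A \<Longrightarrow> f x \<noteq> g y"
  shows "card (f ` A \<union> g ` A) = card (f ` A) + card (g ` A)"
  using assms by (intro card_Un_disjoint) auto

lemma card_classes_tm_smorph:
  assumes "aligned s n" "n \<ge> 1" "j \<ge> 1"
  shows "card (classes (Suc j) (tm_smorph s) (2 * n)) =
    card (classes j s n) + card (bordered_classes j s n)"
proof -
  let ?even = "\<lambda>r. moments (Suc j) (stake (2 * n) (tm_smorph r))"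
  let ?odd = "\<lambda>r. moments (Suc j) (stake (2 * n) (stl (tm_smorph r)))"
  have split: "classes (Suc j) (tm_smorph s) (2 * n) = ?even ` tails s \<union> ?odd ` tails s"
    unfolding classes_def tails_tm_smorph by (simp add: image_Un image_image)
  have "card (?even ` tails s \<union> ?odd ` tails s) = card (?even ` tails s) + card (?odd ` tails s)"
    by (rule card_Un_images) (use aligned_imp_moments_distinct[OF assms] in \<open>simp_all flip: split\<close>)
  moreover have "card (?even ` tails s) = card (classes j s n)"
    unfolding classes_def
    by (rule card_image_eq_if_same_fibres)
      (use moment_equiv_stake_tm_smorph in \<open>simp add: moment_equiv_def\<close>)
  moreover have "card (?odd ` tails s) = card (bordered_classes j s n)"
    unfolding bordered_classes_def
    by (rule card_image_eq_if_same_fibres)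
      (use moment_equiv_stake_stl_tm_smorph[OF assms(2,3)] in \<open>simp add: moment_equiv_def\<close>)
  ultimately show ?thesis by (simp add: split)
qed

lemma card_bordered_classes_tm_smorph:
  assumes "aligned s n" "n \<ge> 1" "j \<ge> 1"
  shows "card (bordered_classes (Suc j) (tm_smorph s) (2 * n)) = 2 * card (bordered_classes j s n)"
proof -
  let ?even = "\<lambda>r. (shd r, moments (Suc j) (stake (2 * n) (tm_smorph r)), r !! n)"
  let ?odd = "\<lambda>r. (\<not> shd r, moments (Suc j) (stake (2 * n) (stl (tm_smorph r))), \<not> r !! n)"
  have split: "bordered_classes (Suc j) (tm_smorph s) (2 * n) = ?even ` tails s \<union> ?odd ` tails s"
    unfolding bordered_classes_def tails_tm_smorph by (simp add: image_Un image_image)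
  have "card (?even ` tails s \<union> ?odd ` tails s) = card (?even ` tails s) + card (?odd ` tails s)"
    by (rule card_Un_images) (use aligned_imp_moments_distinct[OF assms] in \<open>simp_all flip: split\<close>)
  moreover have "card (?even ` tails s) = card (bordered_classes j s n)"
    unfolding bordered_classes_def
    by (rule card_image_eq_if_same_fibres)
      (use moment_equiv_stake_tm_smorph in \<open>simp add: moment_equiv_def\<close>)
  moreover have "card (?odd ` tails s) = card (bordered_classes j s n)"
    unfolding bordered_classes_def
    by (rule card_image_eq_if_same_fibres)
      (use moment_equiv_stake_stl_tm_smorph[OF assms(2,3)] in \<open>auto simp: moment_equiv_def\<close>)
  ultimately show ?thesis by (simp add: split)
qed

lemma card_classes_funpow_tm_smorph:
  assumes "aligned s n" "n \<ge> 2" "j \<ge> 1"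
  shows "card (classes (j + K) ((tm_smorph ^^ K) s) (2 ^ K * n)) =
      card (classes j s n) + (2 ^ K - 1) * card (bordered_classes j s n)"
    and "card (bordered_classes (j + K) ((tm_smorph ^^ K) s) (2 ^ K * n)) =
      2 ^ K * card (bordered_classes j s n)"
proof (induction K)
  case (Suc K)
  let ?z = "(tm_smorph ^^ K) s" and ?m = "2 ^ K * n"
  have m: "?m \<ge> 2" using assms(2) by (metis mult_le_mono one_le_numeral one_le_power mult_1)
  then have aligned: "aligned ?z ?m"
    using assms(1) by (cases K) (auto intro: aligned_tm_smorph)
  have pos: "?m \<ge> 1" "j + K \<ge> 1" using m assms(3) by linarith+
  have unfold_Suc: "2 ^ Suc K * n = 2 * ?m" "j + Suc K = Suc (j + K)"
    "(tm_smorph ^^ Suc K) s = tm_smorph ?z"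
    by simp_all
  obtain P where P: "(2 :: nat) ^ K = Suc P" by (cases "(2 :: nat) ^ K") simp_all
  show "card (classes (j + Suc K) ((tm_smorph ^^ Suc K) s) (2 ^ Suc K * n)) =
      card (classes j s n) + (2 ^ Suc K - 1) * card (bordered_classes j s n)"
    unfolding unfold_Suc card_classes_tm_smorph[OF aligned pos] Suc.IH
    by (simp add: P algebra_simps)
  show "card (bordered_classes (j + Suc K) ((tm_smorph ^^ Suc K) s) (2 ^ Suc K * n)) =
      2 ^ Suc K * card (bordered_classes j s n)"
    unfolding unfold_Suc card_bordered_classes_tm_smorph[OF aligned pos] Suc.IH by simp
qed simp_all

subsection \<open>Balances and borders\<close>

definition balances :: "bool stream \<Rightarrow> nat \<Rightarrow> int set" where
  "balances s n = (\<lambda>r. balance (stake n r)) ` tails s"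

definition borders :: "bool stream \<Rightarrow> nat \<Rightarrow> (bool \<times> int \<times> bool) set" where
  "borders s n = (\<lambda>r. (shd r, balance (stake n r), r !! n)) ` tails s"

lemma card_classes_1: "card (classes (Suc 0) s n) = card (balances s n)"
proof -
  have "classes (Suc 0) s n = (\<lambda>v. [:v:]) ` balances s n"
    by (simp add: classes_def balances_def moments_1 image_image)
  then show ?thesis by (simp add: card_image inj_on_def)
qed

lemma card_bordered_classes_1: "card (bordered_classes (Suc 0) s n) = card (borders s n)"
proof -
  have "bordered_classes (Suc 0) s n = (\<lambda>(a, v, b). (a, [:v:], b)) ` borders s n"
    by (simp add: bordered_classes_def borders_def moments_1 image_image)
  moreover have "inj_on (\<lambda>(a, v, b). (a, [:v:], b)) (borders s n)"
    by (auto intro: inj_onI)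
  ultimately show ?thesis by (simp add: card_image)
qed

lemma finite_borders [simp]: "finite (borders s n)"
proof -
  have "borders s n = (\<lambda>(a, p, b). (a, coeff p 0, b)) ` bordered_classes (Suc 0) s n"
    by (simp add: bordered_classes_def borders_def moments_1 image_image)
  then show ?thesis by simp
qed

lemma balances_eq_image_borders: "balances s n = (\<lambda>(a, v, b). v) ` borders s n"
  by (simp add: balances_def borders_def image_image)

lemma balances_Suc: "balances s (Suc n) = (\<lambda>(a, v, b). v + letter_sign b) ` borders s n"
  by (simp add: balances_def borders_def image_image stake_Suc del: stake.simps)

lemma finite_balances [simp]: "finite (balances s n)"
  by (simp add: balances_eq_image_borders)

lemma balances_nonempty [simp]: "balances s n \<noteq> {}"
  by (auto simp: balances_def tails_def)

lemma balance_stake_stl: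
  "balance (stake n (stl r)) = balance (stake n r) - letter_sign (shd r) + letter_sign (r !! n)"
  using arg_cong[OF stake_Suc[of n r], of balance] by simp

lemma borders_shift:
  assumes "(a, v, b) \<in> borders s n"
  shows "v - letter_sign a + letter_sign b \<in> balances s n"
proof -
  obtain r where "r \<in> tails s" "a = shd r" "v = balance (stake n r)" "b = r !! n"
    using assms by (auto simp: borders_def)
  then show ?thesis
    unfolding balances_def
    by (intro image_eqI[of _ _ "stl r"]) (simp_all add: balance_stake_stl stl_in_tails)
qed

lemma balances_Suc_subset:
  "balances s (Suc n) \<subseteq> (\<lambda>v. v - 1) ` balances s n \<union> (\<lambda>v. v + 1) ` balances s n"
proof -
  have "v + letter_sign b \<in> (\<lambda>v. v - 1) ` balances s n \<union> (\<lambda>v. v + 1) ` balances s n"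
    if "(a, v, b) \<in> borders s n" for a v b
    using that by (cases b) (force simp: balances_eq_image_borders)+
  then show ?thesis by (auto simp: balances_Suc)
qed

lemma balances_1_subset: "balances s 1 \<subseteq> {- 1, 1}"
  by (auto simp: balances_def letter_sign_def)

subsection \<open>Recurrent words\<close>

lemma recurrent_iff:
  "recurrent s \<longleftrightarrow> (\<forall>i n m. \<exists>i'\<ge>m. stake n (sdrop i' s) = stake n (sdrop i s))"
proof -
  have "recurrent s \<longleftrightarrow> (\<forall>i n. infinite {i'. stake n (sdrop i' s) = stake n (sdrop i s)})"
    by (auto simp: recurrent_def factors_eq_UN tails_def occurs_at_def)
  then show ?thesis by (simp add: infinite_nat_iff_unbounded_le)
qed

lemma recurrentD:
  assumes "recurrent s"
  obtains i' where "i' \<ge> m" "stake n (sdrop i' s) = stake n (sdrop i s)"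
  using assms unfolding recurrent_iff by blast

lemma recurrent_imp_factors_sdrop:
  assumes "recurrent s"
  shows "factors (sdrop e s) = factors s"
proof -
  have "stake n (sdrop i s) \<in> factors (sdrop e s)" for i n
  proof -
    obtain i' where "i' \<ge> e" "stake n (sdrop i' s) = stake n (sdrop i s)"
      using assms by (rule recurrentD)
    then show ?thesis
      using stake_in_factors[OF sdrop_in_tails, of n "i' - e" "sdrop e s"] by simp
  qed
  moreover have "stake n (sdrop i (sdrop e s)) \<in> factors s" for i n
    by (simp add: stake_in_factors)
  ultimately show ?thesis
    by (auto elim!: factorsE simp: tails_def) (metis length_stake)+
qed

lemma discrete_crossing:
  fixes f :: "nat \<Rightarrow> 'a::linorder"
  assumes "i \<le> j" "f i \<le> v" "v < f j"
  shows "\<exists>k. f k \<le> v \<and> v < f (Suc k)"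
  using assms
proof (induction j rule: dec_induct)
  case (step j)
  show ?case
  proof (cases "v < f j")
    case False
    then show ?thesis using step.prems(2) by (metis not_less)
  qed (rule step.IH[OF step.prems(1)])
qed simp

text \<open>Recurrence makes the balance of a sliding window come back from every value to every other
  one, hence move both up and down between any two consecutive values.\<close>

lemma crossing_border:
  assumes "recurrent s" "v \<in> balances s n" "w \<in> balances s n"
    and "letter_sign c * v < letter_sign c * w"
  shows "(\<not> c, v, c) \<in> borders s n"
proof -
  define f where "f i = balance (stake n (sdrop i s))" for i
  obtain i where i: "v = f i" using assms(2) by (auto simp: balances_def tails_def f_def)
  obtain j where "w = f j" using assms(3) by (auto simp: balances_def tails_def f_def)
  moreover obtain j' where "j' \<ge> i" "stake n (sdrop j' s) = stake n (sdrop j s)"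
    using assms(1) by (rule recurrentD)
  ultimately have "j' \<ge> i" "w = f j'" by (simp_all add: f_def)
  then have "\<exists>k. letter_sign c * f k \<le> letter_sign c * v \<and>
      letter_sign c * v < letter_sign c * f (Suc k)"
    using assms(4) i
    by (intro discrete_crossing[where f = "\<lambda>i. letter_sign c * f i", of i j']) simp_all
  then obtain k where k: "letter_sign c * f k \<le> letter_sign c * v"
    "letter_sign c * v < letter_sign c * f (Suc k)"
    by blast
  have step: "f (Suc k) = f k - letter_sign (s !! k) + letter_sign (s !! (k + n))"
    using balance_stake_stl[of n "sdrop k s"] by (simp add: f_def sdrop_snth)
  have "even (f k - v)"
    using even_balance_diff_length[of "stake n (sdrop k s)"]
      even_balance_diff_length[of "stake n (sdrop i s)"]
    by (simp add: i f_def)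
  then obtain m where m: "f k = v + 2 * m" by (metis add.commute diff_add_cancel evenE)
  have "m = 0 \<and> s !! k = (\<not> c) \<and> s !! (k + n) = c"
    using k unfolding step m by (cases c; cases "s !! k"; cases "s !! (k + n)") simp_all
  then show ?thesis
    unfolding borders_def
    by (intro image_eqI[of _ _ "sdrop k s"]) (use m in \<open>simp_all add: f_def sdrop_snth\<close>)
qed

lemma card_borders_ge:
  assumes "recurrent s"
  shows "2 * (card (balances s n) - 1) \<le> card (borders s n)"
proof -
  let ?V = "balances s n"
  let ?up = "(\<lambda>v. (False, v, True)) ` (?V - {Max ?V})"
  let ?down = "(\<lambda>v. (True, v, False)) ` (?V - {Min ?V})"
  have "v < Max ?V" if "v \<in> ?V - {Max ?V}" for v
    using that by (metis DiffD1 DiffD2 Max_ge finite_balances insertI1 order_less_le)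
  then have "?up \<subseteq> borders s n"
    using crossing_border[OF assms, of _ n "Max ?V" True] by (auto simp: Max_in)
  moreover have "Min ?V < v" if "v \<in> ?V - {Min ?V}" for v
    using that by (metis DiffD1 DiffD2 Min_le finite_balances insertI1 order_less_le)
  then have "?down \<subseteq> borders s n"
    using crossing_border[OF assms, of _ n "Min ?V" False]
    by (auto simp: Min_in simp del: minus_Min_eq_Max)
  ultimately have "card (?up \<union> ?down) \<le> card (borders s n)" by (intro card_mono) auto
  moreover have "card (?up \<union> ?down) = card ?up + card ?down" by (rule card_Un_disjoint) auto
  moreover have "card ?up = card ?V - 1" "card ?down = card ?V - 1"
    by (simp_all add: card_image inj_on_def Max_in Min_in card_Diff_singleton)
  ultimately show ?thesis by simp
qed

lemma stake_eq_iff_snth: "stake n r = stake n r' \<longleftrightarrow> (\<forall>p<n. r !! p = r' !! p)"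
  by (simp add: list_eq_iff_nth_eq)

lemma recurrent_tm_smorph:
  assumes "recurrent z"
  shows "recurrent (tm_smorph z)"
  unfolding recurrent_iff
proof (intro allI)
  fix i n m :: nat
  define d where "d = i mod 2"
  have "d \<le> 1" by (simp add: d_def)
  have cut: "stake n (sdrop (2 * j + d) (tm_smorph z)) =
      take n (drop d (tm_morph (stake (Suc n) (sdrop j z))))" for j
  proof -
    have "n \<le> 2 * Suc n - d" using \<open>d \<le> 1\<close> by arith
    then have "stake n (sdrop d r) = take n (drop d (stake (2 * Suc n) r))" for r :: "bool stream"
      by (simp only: take_stake drop_stake min_absorb1)
    then show ?thesis using stake_tm_smorph[of "Suc n"]
      by (metis sdrop_add sdrop_tm_smorph)
  qed
  obtain j where j: "j \<ge> m" "stake (Suc n) (sdrop j z) = stake (Suc n) (sdrop (i div 2) z)"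
    using assms by (rule recurrentD)
  have "stake n (sdrop (2 * j + d) (tm_smorph z)) = stake n (sdrop i (tm_smorph z))"
    using cut[of j] cut[of "i div 2"] j(2) by (simp add: d_def del: stake.simps)
  then show "\<exists>i'\<ge>m. stake n (sdrop i' (tm_smorph z)) = stake n (sdrop i (tm_smorph z))"
    using j(1) by (intro exI[of _ "2 * j + d"]) simp
qed

lemma recurrent_if_constant:
  assumes "\<And>p. s !! Suc p = s !! p"
  shows "recurrent s"
proof -
  have "s !! p = s !! 0" for p by (induction p) (use assms in auto)
  then have "stake n (sdrop m s) = stake n (sdrop i s)" for n m i
    by (simp add: stake_eq_iff_snth sdrop_snth)
  then show ?thesis unfolding recurrent_iff by blast
qed

text \<open>Squares of letters occur only at odd positions of an image. Hence a later occurrence of a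
  factor that contains such a square is aligned in the same way.\<close>

lemma recurrent_tm_smorphD:
  assumes "recurrent (tm_smorph z)"
  shows "recurrent z"
proof (cases "\<exists>q. tm_smorph z !! q = tm_smorph z !! Suc q")
  case False
  then have "tm_smorph z !! Suc (2 * p) \<noteq> tm_smorph z !! Suc (Suc (2 * p))" for p by blast
  then have "z !! Suc p = z !! p" for p by (simp add: snth_tm_smorph del: snth.simps)
  then show ?thesis by (rule recurrent_if_constant)
next
  case True
  then obtain q where q: "tm_smorph z !! q = tm_smorph z !! Suc q" ..
  have square_odd: "odd p" if "tm_smorph z !! p = tm_smorph z !! Suc p" for p
    using that snth_tm_smorph[of z p] snth_tm_smorph[of z "Suc p"] by auto
  show ?thesis unfolding recurrent_iff
  proof (intro allI)
    fix i n m
    obtain q' where q': "q' \<ge> 2 * (i + n)"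
      "stake 2 (sdrop q' (tm_smorph z)) = stake 2 (sdrop q (tm_smorph z))"
      using assms by (rule recurrentD)
    then have square: "tm_smorph z !! q' = tm_smorph z !! Suc q'"
      using q by (simp add: stake_eq_iff_snth sdrop_snth All_less_Suc2 numeral_2_eq_2)
    define l where "l = q' - 2 * i"
    obtain i' where i': "i' \<ge> 2 * m"
      "stake (l + 2) (sdrop i' (tm_smorph z)) = stake (l + 2) (sdrop (2 * i) (tm_smorph z))"
      using assms by (rule recurrentD)
    have same: "tm_smorph z !! (i' + p) = tm_smorph z !! (2 * i + p)" if "p < l + 2" for p
      using i'(2) that unfolding stake_eq_iff_snth sdrop_snth by blast
    have "tm_smorph z !! (i' + l) = tm_smorph z !! Suc (i' + l)"
      using same[of l] same[of "Suc l"] square q'(1) by (simp add: l_def del: snth.simps)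
    then have "odd (i' + l)" "odd q'" using square square_odd by blast+
    then have "even i'" using q'(1) by (auto simp: l_def)
    then obtain h where h: "i' = 2 * h" by (rule evenE)
    have "stake (2 * n) (sdrop (2 * h) (tm_smorph z)) = stake (2 * n) (sdrop (2 * i) (tm_smorph z))"
      using same q'(1) by (simp add: stake_eq_iff_snth sdrop_snth l_def h)
    then have "stake n (sdrop h z) = stake n (sdrop i z)"
      by (simp add: sdrop_tm_smorph stake_tm_smorph tm_morph_eq_iff)
    then show "\<exists>i'\<ge>m. stake n (sdrop i' z) = stake n (sdrop i z)" using i'(1) h by auto
  qed
qed

lemma recurrent_funpow_tm_smorph: "recurrent z \<Longrightarrow> recurrent ((tm_smorph ^^ K) z)"
  by (induction K) (simp_all add: recurrent_tm_smorph)

lemma recurrent_imp_left_letter: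
  fixes s :: "'a::finite stream"
  assumes "recurrent s"
  obtains b where "\<And>n. \<exists>i. stake (Suc n) (sdrop i s) = b # stake n s"
proof -
  have "\<exists>b. \<forall>n. \<exists>i. stake (Suc n) (sdrop i s) = b # stake n s"
  proof (rule ccontr)
    assume "\<not> ?thesis"
    then obtain l where l: "\<And>b i. stake (Suc (l b)) (sdrop i s) \<noteq> b # stake (l b) s" by metis
    obtain i where i: "i \<ge> 1"
      "stake (Max (range l)) (sdrop i s) = stake (Max (range l)) (sdrop 0 s)"
      using assms by (rule recurrentD)
    define b where "b = s !! (i - 1)"
    have "l b \<le> Max (range l)" by simp
    then have "stake (l b) (sdrop i s) = stake (l b) s"
      using i(2) unfolding stake_eq_iff_snth by (metis less_le_trans sdrop.simps(1))
    moreover have "stake (Suc (l b)) (sdrop (i - 1) s) = b # stake (l b) (sdrop i s)"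
      using i(1) by (cases i) (simp_all add: b_def)
    ultimately show False using l[of b "i - 1"] by simp
  qed
  then show ?thesis using that by blast
qed

lemma recurrent_extend_left:
  fixes s :: "'a::finite stream"
  assumes "recurrent s"
  obtains b where "recurrent (b ## s)" "factors (b ## s) = factors s"
proof -
  obtain b where b: "\<And>n. \<exists>i. stake (Suc n) (sdrop i s) = b # stake n s"
    using recurrent_imp_left_letter[OF assms] by blast
  have occurs: "\<exists>j. stake n (sdrop i (b ## s)) = stake n (sdrop j s)" for i n
  proof (cases i)
    case 0
    then show ?thesis using b[of "n - 1"] by (cases n) (simp, force)
  next
    case (Suc i')
    then show ?thesis by auto
  qed
  have "recurrent (b ## s)"
    unfolding recurrent_iff
  proof (intro allI)
    fix i n m
    obtain j where j: "stake n (sdrop i (b ## s)) = stake n (sdrop j s)" using occurs by blast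
    obtain i' where "i' \<ge> m" "stake n (sdrop i' s) = stake n (sdrop j s)"
      using assms by (rule recurrentD)
    then show "\<exists>i'\<ge>m. stake n (sdrop i' (b ## s)) = stake n (sdrop i (b ## s))"
      using j by (intro exI[of _ "Suc i'"]) simp
  qed
  then show ?thesis using that recurrent_imp_factors_sdrop[of "b ## s" 1] by simp
qed

lemma tm_smorphI:
  assumes "\<And>i. s !! Suc (2 * i) = (\<not> s !! (2 * i))"
  obtains z where "s = tm_smorph z"
proof
  show "s = tm_smorph (smap (\<lambda>i. s !! (2 * i)) nats)"
    unfolding stream_snth_eq
  proof
    fix n show "s !! n = tm_smorph (smap (\<lambda>i. s !! (2 * i)) nats) !! n"
      by (cases n rule: nat_parity_cases) (simp_all add: snth_tm_smorph assms del: snth.simps(2))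
  qed
qed

lemma abs_balance_stake_diff:
  assumes "\<And>n. odd n \<Longrightarrow> balances s n \<subseteq> {- 1, 1}" "odd (i + j)"
  shows "\<bar>balance (stake j s) - balance (stake i s)\<bar> = 1"
proof -
  have forward: "\<bar>balance (stake j s) - balance (stake i s)\<bar> = 1" if "i \<le> j" "odd (i + j)" for i j
  proof -
    have "stake j s = stake i s @ stake (j - i) (sdrop i s)" using that(1) by simp
    then have "balance (stake j s) = balance (stake i s) + balance (stake (j - i) (sdrop i s))"
      by (simp only: balance_append)
    moreover have "balance (stake (j - i) (sdrop i s)) \<in> balances s (j - i)"
      by (simp add: balances_def)
    then have "balance (stake (j - i) (sdrop i s)) \<in> {- 1, 1}" using assms(1)[of "j - i"] that
      by auto
    ultimately show ?thesis by auto
  qed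
  show ?thesis
    using forward[of i j] forward[of j i] assms(2)
    by (cases "i \<le> j") (simp_all add: add.commute abs_minus_commute)
qed

text \<open>If the walk takes two different values at positions of one parity, then at all positions of
  the other parity it takes the value between them.\<close>

lemma odd_balances_imp_image:
  assumes "\<And>n. odd n \<Longrightarrow> balances s n \<subseteq> {- 1, 1}"
  obtains e z where "e \<le> 1" "sdrop e s = tm_smorph z"
proof -
  define walk where "walk n = balance (stake n s)" for n
  have walk_Suc: "walk (Suc n) = walk n + letter_sign (s !! n)" for n
    by (simp add: walk_def stake_Suc del: stake.simps)
  have step: "\<bar>walk j - walk i\<bar> = 1" if "odd (i + j)" for i j
    unfolding walk_def using assms that by (rule abs_balance_stake_diff)
  have "\<exists>e\<le>1. \<forall>i. walk (e + 2 * i) = walk e"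
  proof (rule ccontr)
    assume not: "\<not> ?thesis"
    obtain i where i: "walk (2 * i) \<noteq> walk 0" using not by (metis add_0 zero_le_one)
    obtain j where j: "walk (1 + 2 * j) \<noteq> walk 1" using not by (metis order_refl)
    show False
      using i j step[of 0 1] step[of 0 "1 + 2 * j"] step[of "2 * i" 1] step[of "2 * i" "1 + 2 * j"]
      by simp
  qed
  then obtain e where e: "e \<le> 1" "\<And>i. walk (e + 2 * i) = walk e" by blast
  have "sdrop e s !! Suc (2 * i) = (\<not> sdrop e s !! (2 * i))" for i
  proof -
    have "walk (Suc (Suc (e + 2 * i))) = walk (e + 2 * i)" using e(2)[of i] e(2)[of "Suc i"] by simp
    then have "letter_sign (s !! (e + 2 * i)) + letter_sign (s !! Suc (e + 2 * i)) = 0"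
      by (simp only: walk_Suc)
    then show ?thesis
      by (auto simp: letter_sign_def sdrop_snth simp del: snth.simps split: if_splits)
  qed
  then obtain z where "sdrop e s = tm_smorph z" by (rule tm_smorphI)
  then show ?thesis using e(1) that by blast
qed

lemma balances_eq_if_factors_eq:
  assumes "factors s = factors t"
  shows "balances s n = balances t n"
proof -
  have "balances r n = balance ` {w \<in> factors r. length w = n}" for r
    unfolding factors_of_length by (simp add: balances_def image_image)
  then show ?thesis by (simp add: assms)
qed

text \<open>If only the tail of s is an image, then so is an extension of s to the left.\<close>

lemma odd_balances_imp_desubstitution:
  assumes "recurrent s" "\<And>n. odd n \<Longrightarrow> balances s n \<subseteq> {- 1, 1}"
  obtains d z where "d \<le> 1" "recurrent z" "s = sdrop d (tm_smorph z)"
proof -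
  have "\<exists>d\<le>1. \<exists>z. s = sdrop d (tm_smorph z) \<and> recurrent (tm_smorph z)"
  proof (cases "\<exists>z. s = tm_smorph z")
    case True
    then show ?thesis using assms(1) by (metis sdrop.simps(1) zero_le_one)
  next
    case False
    obtain b where b: "recurrent (b ## s)" "factors (b ## s) = factors s"
      using assms(1) by (rule recurrent_extend_left)
    have "balances (b ## s) n \<subseteq> {- 1, 1}" if "odd n" for n
      using assms(2)[OF that] by (simp only: balances_eq_if_factors_eq[OF b(2)])
    then obtain e z where e: "e \<le> 1" "sdrop e (b ## s) = tm_smorph z"
      by (rule odd_balances_imp_image)
    then have "e = 0" using False by (cases e) auto
    then have "b ## s = tm_smorph z" using e(2) by simp
    moreover from this[symmetric] have "s = sdrop 1 (tm_smorph z)" by simp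
    ultimately show ?thesis using b(1) by (metis order_refl)
  qed
  then show ?thesis using that recurrent_tm_smorphD by blast
qed

subsection \<open>The Thue--Morse word\<close>

definition tm_balances :: "nat \<Rightarrow> int set" where
  "tm_balances n = (if even n then {- 2, 0, 2} else {- 1, 1})"

definition tm_borders :: "nat \<Rightarrow> (bool \<times> int \<times> bool) set" where
  "tm_borders n =
     (if even n
      then {(False, - 2, True), (False, 0, False), (False, 0, True),
        (True, 0, False), (True, 0, True), (True, 2, False)}
      else {(False, - 1, False), (False, - 1, True), (False, 1, False),
        (True, - 1, True), (True, 1, False), (True, 1, True)})"

definition letter_pairs :: "bool stream \<Rightarrow> nat \<Rightarrow> (bool \<times> bool) set" where
  "letter_pairs z n = (\<lambda>r. (shd r, r !! n)) ` tails z"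

lemma card_tm_balances: "card (tm_balances n) = (if even n then 3 else 2)"
  by (simp add: tm_balances_def)

lemma card_tm_borders: "card (tm_borders n) = 6"
  by (simp add: tm_borders_def)

lemma middle_tm_borders: "(\<lambda>(a, v, b). v) ` tm_borders n = tm_balances n"
  by (auto simp: tm_borders_def tm_balances_def)

lemma borders_tm_smorph_even:
  "borders (tm_smorph z) (2 * n) =
     (\<lambda>(a, b). (a, 0, b)) ` letter_pairs z n \<union>
     (\<lambda>(a, b). (\<not> a, letter_sign b - letter_sign a, \<not> b)) ` letter_pairs z n"
  by (simp add: borders_def letter_pairs_def tails_tm_smorph image_Un image_image
      balance_stake_stl stake_tm_smorph)

lemma borders_tm_smorph_odd:
  "borders (tm_smorph z) (Suc (2 * n)) =
     (\<lambda>(a, b). (a, letter_sign b, \<not> b)) ` letter_pairs z n \<union>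
     (\<lambda>(a, b). (\<not> a, - letter_sign a, b)) ` letter_pairs z (Suc n)"
proof -
  have "stl (tm_smorph r) !! Suc (2 * n) = r !! Suc n" for r
    using snth_tm_smorph_double(1)[of r "Suc n"] by simp
  then show ?thesis
    by (simp add: borders_def letter_pairs_def tails_tm_smorph image_Un image_image
        balance_stake_stl stake_Suc_tm_smorph del: stake.simps snth.simps)
      simp
qed

lemma thue_morse_double:
  "thue_morse !! (2 * i) = thue_morse !! i"
  "thue_morse !! Suc (2 * i) = (\<not> thue_morse !! i)"
  using snth_tm_smorph[of thue_morse "2 * i"] snth_tm_smorph[of thue_morse "Suc (2 * i)"]
  by (simp_all add: thue_morse_fixpoint del: snth.simps)

lemma thue_morse_letters:
  assumes "n \<ge> 1"
  shows "\<exists>i. thue_morse !! i = a \<and> thue_morse !! (i + n) = b"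
  using assms
proof (induction n arbitrary: a b rule: less_induct)
  case (less n)
  show ?case
  proof (cases n rule: nat_parity_cases)
    case (even h)
    then obtain i where "thue_morse !! i = a" "thue_morse !! (i + h) = b"
      using less.IH[of h] less.prems by auto
    then show ?thesis
      using thue_morse_double(1)[of "i + h"]
      by (intro exI[of _ "2 * i"]) (simp add: even thue_morse_double distrib_left)
  next
    case (odd h)
    show ?thesis
    proof (cases "h = 0")
      case True
      have "\<not> thue_morse !! 0" "thue_morse !! 1" "thue_morse !! 2" "\<not> thue_morse !! 3"
        "\<not> thue_morse !! 5" "\<not> thue_morse !! 6"
        using thue_morse_fixpoint(2) thue_morse_double(1)[of 1] thue_morse_double(1)[of 3]
          thue_morse_double(2)[of 0] thue_morse_double(2)[of 1] thue_morse_double(2)[of 2]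
        by (simp_all add: eval_nat_numeral)
      then show ?thesis
        by (intro exI[of _ "if a then if b then 1 else 2 else if b then 0 else 5"])
          (simp add: odd True eval_nat_numeral)
    next
      case False
      then obtain i where "thue_morse !! i = a" "thue_morse !! (i + h) = (\<not> b)"
        using less.IH[of h a "\<not> b"] odd by auto
      then show ?thesis
        using thue_morse_double(2)[of "i + h"]
        by (intro exI[of _ "2 * i"]) (simp add: odd thue_morse_double distrib_left del: snth.simps)
    qed
  qed
qed

lemma letter_pairs_thue_morse:
  assumes "n \<ge> 1"
  shows "letter_pairs thue_morse n = {(False, False), (False, True), (True, False), (True, True)}"
proof -
  have "(a, b) \<in> letter_pairs thue_morse n" for a b
  proof -
    obtain i where "thue_morse !! i = a" "thue_morse !! (i + n) = b"
      using thue_morse_letters[OF assms] by blast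
    then show ?thesis
      unfolding letter_pairs_def
      by (intro image_eqI[of _ _ "sdrop i thue_morse"]) (auto simp: sdrop_snth)
  qed
  then show ?thesis by auto
qed

lemma borders_thue_morse:
  assumes "n \<ge> 2"
  shows "borders thue_morse n = tm_borders n"
proof (cases n rule: nat_parity_cases)
  case (even h)
  then have "h \<ge> 1" using assms by simp
  then have "borders (tm_smorph thue_morse) n = tm_borders n"
    unfolding even borders_tm_smorph_even by (simp add: letter_pairs_thue_morse tm_borders_def) auto
  then show ?thesis by (simp add: thue_morse_fixpoint)
next
  case (odd h)
  then have "h \<ge> 1" using assms by simp
  then have "borders (tm_smorph thue_morse) n = tm_borders n"
    unfolding odd borders_tm_smorph_odd by (simp add: letter_pairs_thue_morse tm_borders_def) auto
  then show ?thesis by (simp add: thue_morse_fixpoint)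
qed

lemma balances_thue_morse:
  assumes "n \<ge> 1"
  shows "balances thue_morse n = tm_balances n"
proof (cases "n = 1")
  case True
  have "letter_sign (\<not> a) \<in> balances (tm_smorph thue_morse) (Suc (2 * 0))" for a
    unfolding balances_eq_image_borders borders_tm_smorph_odd
    by (cases a) (simp_all add: letter_pairs_thue_morse)
  from this[of True] this[of False] show ?thesis
    using True balances_1_subset[of thue_morse] by (auto simp: thue_morse_fixpoint tm_balances_def)
next
  case False
  then show ?thesis
    using assms by (simp add: balances_eq_image_borders borders_thue_morse middle_tm_borders)
qed

lemma aligned_thue_morse: "n \<ge> 2 \<Longrightarrow> aligned thue_morse n"
  using aligned_tm_smorph[of n thue_morse] by (simp add: thue_morse_fixpoint)

lemma funpow_tm_smorph_thue_morse: "(tm_smorph ^^ K) thue_morse = thue_morse"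
  by (induction K) (simp_all add: thue_morse_fixpoint)

lemma card_classes_thue_morse:
  assumes "n \<ge> 2"
  shows "card (classes (Suc K) thue_morse (2 ^ K * n)) = card (tm_balances n) + (2 ^ K - 1) * 6"
  using card_classes_funpow_tm_smorph(1)[OF aligned_thue_morse[OF assms] assms, of 1 K] assms
  by (simp add: funpow_tm_smorph_thue_morse card_classes_1 card_bordered_classes_1
      balances_thue_morse borders_thue_morse card_tm_borders)

subsection \<open>Determining the balances\<close>

lemma even_step_borders:
  assumes "recurrent s" "balances s n = {- 2, 0, 2}"
  shows "{(False, - 2, True), (False, 0, True), (True, 0, False), (True, 2, False)} \<subseteq> borders s n"
  using crossing_border[OF assms(1), of _ n 2 True]
    crossing_border[OF assms(1), of _ n "- 2" False] assms(2)
  by simp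

lemma even_step_balances_supset:
  assumes "recurrent s" "balances s n = {- 2, 0, 2}"
  shows "{- 1, 1} \<subseteq> balances s (Suc n)"
  using even_step_borders[OF assms] by (force simp: balances_Suc)

lemma balances_step_if_card:
  assumes "recurrent s" "balances s n = tm_balances n"
    and "card (balances s (Suc n)) = card (tm_balances (Suc n))"
  shows "balances s (Suc n) = tm_balances (Suc n)"
proof (cases "even n")
  case True
  then have "tm_balances (Suc n) \<subseteq> balances s (Suc n)"
    using even_step_balances_supset[OF assms(1), of n] assms(2) by (simp add: tm_balances_def)
  then show ?thesis using assms(3) by (intro card_subset_eq[symmetric]) simp_all
next
  case False
  then have "balances s (Suc n) \<subseteq> tm_balances (Suc n)"
    using balances_Suc_subset[of s n] assms(2) by (auto simp: tm_balances_def)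
  then show ?thesis using assms(3) by (intro card_subset_eq) (simp_all add: tm_balances_def)
qed

definition even_start_class :: "nat \<Rightarrow> bool \<times> int \<times> bool \<Rightarrow> int poly" where
  "even_start_class l = (\<lambda>(a, v, b).
     if even l then [:0, - v:]
     else [:letter_sign b, int (l - 1) * letter_sign b - v:])"

definition odd_start_class :: "nat \<Rightarrow> bool \<times> int \<times> bool \<Rightarrow> int poly" where
  "odd_start_class l = (\<lambda>(a, v, b).
     if even l
     then [:letter_sign b - letter_sign a, int (l - 1) * letter_sign b + letter_sign a - v:]
     else [:- letter_sign a, letter_sign a - letter_sign b - v:])"

definition even_start_bordered_class :: "nat \<Rightarrow> bool \<times> int \<times> bool \<Rightarrow> bool \<times> int poly \<times> bool" where
  "even_start_bordered_class l = (\<lambda>(a, v, b). (a, even_start_class l (a, v, b), b))"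

definition odd_start_bordered_class :: "nat \<Rightarrow> bool \<times> int \<times> bool \<Rightarrow> bool \<times> int poly \<times> bool" where
  "odd_start_bordered_class l = (\<lambda>(a, v, b). (\<not> a, odd_start_class l (a, v, b), \<not> b))"

lemma moments_2_even_start:
  "moments 2 (stake l (tm_smorph r)) =
     even_start_class l (shd r, balance (stake (l div 2) r), r !! (l div 2))"
proof (cases l rule: nat_parity_cases)
  case (even n)
  then show ?thesis
    by (simp add: even_start_class_def moments_2 stake_tm_smorph linear_coeff_tm_morph)
next
  case (odd n)
  then show ?thesis
    unfolding odd stake_Suc_tm_smorph
    by (simp add: even_start_class_def moments_2 linear_coeff_append linear_coeff_tm_morph)
qed

lemma moments_2_odd_start:
  assumes "l \<ge> 1"
  shows "moments 2 (stake l (stl (tm_smorph r))) =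
    odd_start_class l (shd r, balance (stake (l div 2) r), r !! (l div 2))"
proof (cases l rule: nat_parity_cases)
  case (even n)
  then obtain m where l: "l = 2 * Suc m" using assms by (cases n) auto
  show ?thesis
    unfolding l stake_Suc_stl_tm_smorph
    by (simp add: odd_start_class_def moments_2 linear_coeff_append linear_coeff_tm_morph
        algebra_simps)
next
  case (odd n)
  then show ?thesis
    unfolding odd stake_stl_tm_smorph
    by (simp add: odd_start_class_def moments_2 linear_coeff_tm_morph balance_stake_stl)
qed

lemma classes_2_tm_smorph:
  assumes "l \<ge> 1"
  shows "classes 2 (tm_smorph s) l =
    even_start_class l ` borders s (l div 2) \<union> odd_start_class l ` borders s (l div 2)"
  unfolding classes_def borders_def tails_tm_smorph image_Un image_image
  by (simp only: moments_2_even_start moments_2_odd_start[OF assms])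

lemma bordered_classes_2_tm_smorph:
  assumes "n \<ge> 1"
  shows "bordered_classes 2 (tm_smorph s) (2 * n) =
    even_start_bordered_class (2 * n) ` borders s n \<union>
    odd_start_bordered_class (2 * n) ` borders s n"
  using moments_2_even_start[of "2 * n"] moments_2_odd_start[of "2 * n"] assms
  unfolding bordered_classes_def borders_def tails_tm_smorph image_Un image_image
  by (simp add: even_start_bordered_class_def odd_start_bordered_class_def)

lemma card_classes_2_thue_morse:
  assumes "n \<ge> 2"
  shows "card (classes 2 thue_morse (Suc (2 * n))) = 8"
proof -
  have "classes 2 (tm_smorph thue_morse) (Suc (2 * n)) =
      even_start_class (Suc (2 * n)) ` tm_borders n \<union> odd_start_class (Suc (2 * n)) ` tm_borders n"
    using assms by (simp add: classes_2_tm_smorph borders_thue_morse)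
  also have "card \<dots> = 8"
    using assms
    by (cases "even n")
      (simp_all add: tm_borders_def even_start_class_def odd_start_class_def card_insert_if)
  finally show ?thesis by (simp add: thue_morse_fixpoint)
qed

text \<open>With balances -2, 0 and 2 at least eight classes exist, with balances -1 and 1 at most
  eight.\<close>

lemma balances_even_step_if_card_classes_2:
  assumes "recurrent s" "balances s n = {- 2, 0, 2}" "n \<ge> 2"
    and "card (classes 2 (tm_smorph s) (Suc (2 * n))) = 8"
  shows "balances s (Suc n) = {- 1, 1}"
proof -
  let ?B = "{(False, - 2, True), (False, 0, True), (True, 0, False), (True, 2, False)}"
  let ?even = "even_start_class (Suc (2 * n))" and ?odd = "odd_start_class (Suc (2 * n))"
  have B: "?B \<subseteq> borders s n" by (rule even_step_borders[OF assms(1,2)])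
  have split: "classes 2 (tm_smorph s) (Suc (2 * n)) = ?even ` borders s n \<union> ?odd ` borders s n"
    by (simp add: classes_2_tm_smorph)
  have classes: "?even ` ?B \<union> ?odd ` ?B = classes 2 (tm_smorph s) (Suc (2 * n))"
  proof (rule card_subset_eq)
    show "?even ` ?B \<union> ?odd ` ?B \<subseteq> classes 2 (tm_smorph s) (Suc (2 * n))"
      unfolding split by (intro Un_mono image_mono B)
    show "card (?even ` ?B \<union> ?odd ` ?B) = card (classes 2 (tm_smorph s) (Suc (2 * n)))"
      using assms(3) by (simp add: assms(4) even_start_class_def odd_start_class_def card_insert_if)
  qed simp
  have "v + letter_sign b \<in> {- 1, 1}" if "(a, v, b) \<in> borders s n" for a v b
  proof -
    have "?even (a, v, b) \<in> ?even ` ?B \<union> ?odd ` ?B"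
      unfolding classes split by (intro UnI1 imageI that)
    moreover have "v \<in> {- 2, 0, 2}"
      using that assms(2) unfolding balances_eq_image_borders by force
    ultimately show ?thesis
      using assms(3) by (cases b) (auto simp: even_start_class_def odd_start_class_def)
  qed
  then have "balances s (Suc n) \<subseteq> {- 1, 1}" by (auto simp: balances_Suc)
  then show ?thesis using even_step_balances_supset[OF assms(1,2)] by blast
qed

lemma odd_step_borders_if_card_classes_2:
  assumes "balances s n = {- 1, 1}" "n \<ge> 2" "card (classes 2 (tm_smorph s) (Suc (2 * n))) = 8"
    and "v \<in> {- 1, 1}"
  shows "\<exists>a. (a, v, b) \<in> borders s n"
proof -
  let ?even = "even_start_class (Suc (2 * n))" and ?odd = "odd_start_class (Suc (2 * n))"
  define A where
    "A = (\<lambda>(v, b). [:letter_sign b, 2 * int n * letter_sign b - v:]) ` ({- 1, 1} \<times> UNIV)"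
  define B where "B = {[:- 1, - 1:], [:- 1, 1:], [:1, - 1:], [:1, 1 :: int:]}"
  have "v \<in> {- 1, 1}" if "(a, v, b) \<in> borders s n" for a v b
    using that assms(1) unfolding balances_eq_image_borders by force
  then have A: "?even ` borders s n \<subseteq> A"
    by (force simp: A_def even_start_class_def)
  have "?odd (a, v, b) \<in> B" if "(a, v, b) \<in> borders s n" for a v b
    using borders_shift[OF that] assms(1)
    by (cases a; cases b) (auto simp: B_def odd_start_class_def)
  then have B: "?odd ` borders s n \<subseteq> B" by auto
  have "?even ` borders s n \<union> ?odd ` borders s n = A \<union> B"
  proof (rule card_subset_eq)
    have "card (?even ` borders s n \<union> ?odd ` borders s n) = 8"
      using classes_2_tm_smorph[of "Suc (2 * n)" s] assms(3) by simp
    also have "8 = card (A \<union> B)"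
      using assms(2) by (simp add: A_def B_def UNIV_bool insert_Times_insert card_insert_if)
    finally show "card (?even ` borders s n \<union> ?odd ` borders s n) = card (A \<union> B)" .
  qed (use A B in \<open>auto simp: A_def B_def\<close>)
  moreover have "A \<inter> B = {}" using assms(2) by (auto simp: A_def B_def letter_sign_def)
  moreover have "[:letter_sign b, 2 * int n * letter_sign b - v:] \<in> A"
    using assms(4) by (auto simp: A_def)
  ultimately obtain t where "t \<in> borders s n"
    "[:letter_sign b, 2 * int n * letter_sign b - v:] = ?even t"
    using B by blast
  then have "(fst t, v, b) \<in> borders s n" by (cases t) (auto simp: even_start_class_def)
  then show ?thesis ..
qed

lemma balances_odd_step_if_card_classes_2:
  assumes "balances s n = {- 1, 1}" "n \<ge> 2" "card (classes 2 (tm_smorph s) (Suc (2 * n))) = 8"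
  shows "balances s (Suc n) = {- 2, 0, 2}"
proof -
  have "v + letter_sign b \<in> balances s (Suc n)" if "v \<in> {- 1, 1}" for v b
    using odd_step_borders_if_card_classes_2[OF assms that, of b]
    unfolding balances_Suc by (auto intro: rev_image_eqI)
  from this[of 1 True] this[of 1 False] this[of "- 1" False]
  have "{- 2, 0, 2} \<subseteq> balances s (Suc n)" by simp
  moreover have "balances s (Suc n) \<subseteq> {- 2, 0, 2}"
    using balances_Suc_subset[of s n] assms(1) by auto
  ultimately show ?thesis by blast
qed

lemma balances_step_if_card_classes_2:
  assumes "recurrent s" "balances s n = tm_balances n" "n \<ge> 2"
    and "card (classes 2 (tm_smorph s) (Suc (2 * n))) = 8"
  shows "balances s (Suc n) = tm_balances (Suc n)"
  using assms balances_even_step_if_card_classes_2[of s n]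
    balances_odd_step_if_card_classes_2[of s n]
  by (cases "even n") (simp_all add: tm_balances_def)

lemma borders_2_cases:
  assumes "t \<in> borders s 2"
  obtains "t \<in> tm_borders 2" | c where "t = (c, 2 * letter_sign c, c)"
proof -
  obtain a m b where "t = (a, letter_sign a + letter_sign m, b)"
    using assms by (auto simp: borders_def numeral_2_eq_2)
  then show ?thesis
    using that(1) that(2)[of a] by (cases a; cases m; cases b) (simp_all add: tm_borders_def)
qed

text \<open>The six borders of the Thue--Morse word contribute one class and two bordered classes each,
  beyond the three classes that come from the balances. A cube of a letter contributes only to
  the bordered classes. So a missing border makes the total too small, and a cube next to all six
  borders makes it too large.\<close>

lemma card_classes_2_length_4_le:
  "card (classes 2 (tm_smorph s) 4) \<le> 3 + card (borders s 2 \<inter> tm_borders 2)"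
proof -
  let ?Q = "borders s 2 \<inter> tm_borders 2" and ?A = "{[:0, 2:], [:0, 0:], [:0, - 2 :: int:]}"
  have "even_start_class 4 t \<in> ?A \<and> odd_start_class 4 t \<in> ?A \<union> odd_start_class 4 ` ?Q"
    if "t \<in> borders s 2" for t
    using that
  proof (cases rule: borders_2_cases)
    case 1
    then show ?thesis using that by (auto simp: tm_borders_def even_start_class_def)
  next
    case (2 c)
    then show ?thesis by (cases c) (simp_all add: even_start_class_def odd_start_class_def)
  qed
  then have "classes 2 (tm_smorph s) 4 \<subseteq> ?A \<union> odd_start_class 4 ` ?Q"
    by (auto simp: classes_2_tm_smorph)
  then have "card (classes 2 (tm_smorph s) 4) \<le> card (?A \<union> odd_start_class 4 ` ?Q)"
    by (rule card_mono[rotated]) simp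
  also have "\<dots> \<le> card ?A + card (odd_start_class 4 ` ?Q)" by (rule card_Un_le)
  also have "\<dots> \<le> 3 + card ?Q" by (intro add_mono card_image_le) simp_all
  finally show ?thesis .
qed

lemma bordered_classes_2_tm_smorph_length_4:
  "bordered_classes 2 (tm_smorph s) 4 =
     even_start_bordered_class 4 ` borders s 2 \<union> odd_start_bordered_class 4 ` borders s 2"
  using bordered_classes_2_tm_smorph[of 2 s] by simp

lemma card_bordered_classes_2_length_4_le:
  "card (bordered_classes 2 (tm_smorph s) 4) \<le> 2 + 2 * card (borders s 2 \<inter> tm_borders 2)"
proof -
  let ?Q = "borders s 2 \<inter> tm_borders 2"
  let ?C = "{(False, [:0, 2:], False), (True, [:0, - 2 :: int:], True)}"
  let ?even = "even_start_bordered_class 4" and ?odd = "odd_start_bordered_class 4"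
  let ?R = "?C \<union> (?even ` ?Q \<union> ?odd ` ?Q)"
  have "?even t \<in> ?R \<and> ?odd t \<in> ?R" if "t \<in> borders s 2" for t
    using that
  proof (cases rule: borders_2_cases)
    case 1
    then show ?thesis using that by blast
  next
    case (2 c)
    then show ?thesis
      by (cases c) (simp_all add: even_start_bordered_class_def odd_start_bordered_class_def
          even_start_class_def odd_start_class_def)
  qed
  then have "bordered_classes 2 (tm_smorph s) 4 \<subseteq> ?R"
    unfolding bordered_classes_2_tm_smorph_length_4 by (intro Un_least image_subsetI) simp_all
  then have "card (bordered_classes 2 (tm_smorph s) 4) \<le> card ?R"
    by (rule card_mono[rotated]) simp
  also have "\<dots> \<le> card ?C + (card (?even ` ?Q) + card (?odd ` ?Q))"
    by (rule order_trans[OF card_Un_le add_left_mono[OF card_Un_le]])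
  also have "\<dots> \<le> 2 + (card ?Q + card ?Q)" by (intro add_mono card_image_le) simp_all
  finally show ?thesis by simp
qed

definition weighted_class_count :: "nat \<Rightarrow> bool stream \<Rightarrow> nat" where
  "weighted_class_count M s =
     card (classes 2 (tm_smorph s) 4) + M * card (bordered_classes 2 (tm_smorph s) 4)"

lemma tm_borders_subset_if_weighted_class_count:
  assumes "weighted_class_count M s = 9 + M * 12"
  shows "tm_borders 2 \<subseteq> borders s 2"
proof (rule ccontr)
  let ?Q = "borders s 2 \<inter> tm_borders 2"
  assume "\<not> tm_borders 2 \<subseteq> borders s 2"
  then have "card ?Q < card (tm_borders 2)"
    by (intro psubset_card_mono) (auto simp: tm_borders_def)
  then have "card ?Q \<le> 5" by (simp add: card_tm_borders)
  then have "card (classes 2 (tm_smorph s) 4) \<le> 8" "card (bordered_classes 2 (tm_smorph s) 4) \<le> 12"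
    using card_classes_2_length_4_le[of s] card_bordered_classes_2_length_4_le[of s] by linarith+
  then have "weighted_class_count M s \<le> 8 + M * 12"
    unfolding weighted_class_count_def by (intro add_mono mult_le_mono) simp_all
  then show False using assms by linarith
qed

lemma no_cube_border_if_weighted_class_count:
  assumes "weighted_class_count M s = 9 + M * 12" "M \<ge> 1"
  shows "(c, 2 * letter_sign c, c) \<notin> borders s 2"
proof
  assume cube: "(c, 2 * letter_sign c, c) \<in> borders s 2"
  let ?B = "tm_borders 2"
  let ?classes = "even_start_class 4 ` ?B \<union> odd_start_class 4 ` ?B"
  let ?bordered = "even_start_bordered_class 4 ` insert (c, 2 * letter_sign c, c) ?B \<union>
    odd_start_bordered_class 4 ` ?B"
  have B: "?B \<subseteq> borders s 2" using assms(1) by (rule tm_borders_subset_if_weighted_class_count)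
  have "classes 2 (tm_smorph s) 4 =
      even_start_class 4 ` borders s 2 \<union> odd_start_class 4 ` borders s 2"
    by (simp add: classes_2_tm_smorph)
  then have "?classes \<subseteq> classes 2 (tm_smorph s) 4"
    by (simp only: Un_mono image_mono B)
  then have "card ?classes \<le> card (classes 2 (tm_smorph s) 4)"
    by (rule card_mono[OF finite_classes])
  moreover have "card ?classes = 9"
    by (simp add: tm_borders_def even_start_class_def odd_start_class_def card_insert_if)
  moreover have "?bordered \<subseteq> bordered_classes 2 (tm_smorph s) 4"
    by (simp only: bordered_classes_2_tm_smorph_length_4 Un_mono image_mono insert_subsetI cube B)
  then have "card ?bordered \<le> card (bordered_classes 2 (tm_smorph s) 4)"
    by (rule card_mono[OF finite_bordered_classes])
  moreover have "card ?bordered = 13"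
    by (cases c)
      (simp_all add: tm_borders_def even_start_bordered_class_def odd_start_bordered_class_def
        even_start_class_def odd_start_class_def card_insert_if)
  ultimately have "9 + M * 13 \<le> weighted_class_count M s"
    unfolding weighted_class_count_def by (intro add_mono mult_le_mono) simp_all
  then show False using assms by linarith
qed

lemma cube_factor_imp_border:
  assumes "replicate 3 c \<in> factors s"
  shows "(c, 2 * letter_sign c, c) \<in> borders s 2"
proof -
  obtain r where "r \<in> tails s" "replicate 3 c = stake 3 r"
    using factorsE[OF assms] by auto
  then show ?thesis
    unfolding borders_def by (intro image_eqI[of _ _ r]) (auto simp: eval_nat_numeral)
qed

lemma aligned_2_if_no_cube_border:
  assumes "\<And>c. (c, 2 * letter_sign c, c) \<notin> borders s 2"
  shows "aligned s 2"
  using assms cube_factor_imp_border[of _ s] by (auto simp: aligned_def eval_nat_numeral)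

lemma balances_if_tm_borders_subset:
  assumes "tm_borders 2 \<subseteq> borders s 2"
  shows "balances s 1 = tm_balances 1" "balances s 2 = tm_balances 2"
proof -
  have "tm_balances 2 \<subseteq> balances s 2"
    unfolding balances_eq_image_borders middle_tm_borders[symmetric] using assms by (rule image_mono)
  moreover have neighbours: "balances s 2 \<subseteq> (\<lambda>v. v - 1) ` balances s 1 \<union> (\<lambda>v. v + 1) ` balances s 1"
    using balances_Suc_subset[of s 1] by (simp add: numeral_2_eq_2)
  moreover have "(\<lambda>v. v - 1) ` balances s 1 \<union> (\<lambda>v. v + 1) ` balances s 1 \<subseteq> tm_balances 2"
    using balances_1_subset[of s] by (auto simp: tm_balances_def)
  ultimately show two: "balances s 2 = tm_balances 2" by blast
  have "v - 1 \<in> balances s 1 \<or> v + 1 \<in> balances s 1" if "v \<in> tm_balances 2" for v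
    using neighbours that unfolding two by fastforce
  from this[of 2] this[of "- 2"] have "{- 1, 1} \<subseteq> balances s 1"
    using balances_1_subset[of s] by (auto simp: tm_balances_def)
  then show "balances s 1 = tm_balances 1"
    using balances_1_subset[of s] by (auto simp: tm_balances_def)
qed

subsection \<open>Words with the class counts of the Thue--Morse word\<close>

definition tm_balanced :: "bool stream \<Rightarrow> bool" where
  "tm_balanced s \<longleftrightarrow> (\<forall>n\<ge>1. balances s n = tm_balances n)"

definition tm_class_counts :: "nat \<Rightarrow> bool stream \<Rightarrow> bool" where
  "tm_class_counts K s \<longleftrightarrow>
     (\<forall>n. card (classes (Suc K) ((tm_smorph ^^ K) s) n) = card (classes (Suc K) thue_morse n))"

lemma tm_balanced_if_card_balances:
  assumes "recurrent s" "balances s 1 = tm_balances 1"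
    and "\<And>n. n \<ge> 2 \<Longrightarrow> card (balances s n) = card (tm_balances n)"
  shows "tm_balanced s"
  unfolding tm_balanced_def
proof (intro allI impI)
  fix n :: nat assume "n \<ge> 1"
  then show "balances s n = tm_balances n"
  proof (induction n rule: nat_induct_at_least)
    case (Suc n)
    then show ?case using balances_step_if_card[OF assms(1)] assms(3)[of "Suc n"] by simp
  qed (rule assms(2))
qed

lemma tm_class_counts_0_imp_tm_balanced:
  assumes "recurrent s" "tm_class_counts 0 s"
  shows "tm_balanced s"
proof -
  have card: "card (balances s n) = card (tm_balances n)" if "n \<ge> 1" for n
    using assms(2) balances_thue_morse[OF that] by (simp add: tm_class_counts_def card_classes_1)
  have "balances s 1 = tm_balances 1"
    using card[of 1] balances_1_subset[of s]
    by (intro card_subset_eq) (simp_all add: tm_balances_def)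
  then show ?thesis by (rule tm_balanced_if_card_balances[OF assms(1)]) (simp add: card)
qed

lemma tm_class_counts_Suc_imp_weighted_class_count:
  assumes "tm_class_counts (Suc K) s"
  shows "weighted_class_count (2 ^ K - 1) s = 9 + (2 ^ K - 1) * 12"
proof -
  obtain P where P: "(2 :: nat) ^ K = Suc P" by (cases "(2 :: nat) ^ K") simp_all
  have "card (classes (2 + K) ((tm_smorph ^^ K) (tm_smorph s)) (2 ^ K * 4)) =
      weighted_class_count (2 ^ K - 1) s"
    unfolding weighted_class_count_def
    by (rule card_classes_funpow_tm_smorph(1)) (simp_all add: aligned_tm_smorph)
  moreover have "card (classes (2 + K) ((tm_smorph ^^ K) (tm_smorph s)) (2 ^ K * 4)) =
      card (classes (Suc (Suc K)) thue_morse (2 ^ Suc K * 2))"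
    using assms[unfolded tm_class_counts_def, rule_format, of "2 ^ Suc K * 2"]
    by (simp add: funpow_swap1 mult.commute)
  moreover have "card (classes (Suc (Suc K)) thue_morse (2 ^ Suc K * 2)) = 9 + (2 ^ K - 1) * 12"
    using card_classes_thue_morse[of 2 "Suc K"] by (simp add: card_tm_balances P)
  ultimately show ?thesis by simp
qed

lemma tm_class_counts_1_imp_tm_balanced:
  assumes "recurrent s" "tm_class_counts 1 s"
  shows "tm_balanced s"
proof -
  have count: "card (classes 2 (tm_smorph s) n) = card (classes 2 thue_morse n)" for n
    using assms(2) by (simp add: tm_class_counts_def numeral_2_eq_2)
  have "tm_borders 2 \<subseteq> borders s 2"
    using tm_class_counts_Suc_imp_weighted_class_count[of 0 s] assms(2)
    by (intro tm_borders_subset_if_weighted_class_count[where M = 0]) simp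
  note short = balances_if_tm_borders_subset[OF this]
  have "balances s n = tm_balances n" if "n \<ge> 2" for n
    using that
  proof (induction n rule: nat_induct_at_least)
    case (Suc n)
    then show ?case
      using balances_step_if_card_classes_2[OF assms(1)] card_classes_2_thue_morse
      by (simp add: count)
  qed (rule short(2))
  moreover have "n = 1 \<or> n \<ge> 2" if "n \<ge> 1" for n :: nat using that by linarith
  ultimately show ?thesis unfolding tm_balanced_def using short(1) by metis
qed

lemma card_balances_eq_if_total:
  assumes "recurrent s" "M \<ge> 3"
    and total: "card (balances s n) + M * card (borders s n) = card (tm_balances n) + M * 6"
  shows "card (balances s n) = card (tm_balances n)"
proof -
  have tm: "2 \<le> card (tm_balances n)" "card (tm_balances n) \<le> 3" by (simp_all add: card_tm_balances)
  have pos: "card (balances s n) \<ge> 1" by (simp add: Suc_le_eq card_gt_0_iff)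
  have le: "card (balances s n) \<le> 3"
  proof (rule ccontr)
    assume "\<not> card (balances s n) \<le> 3"
    then have "card (borders s n) \<ge> 6" using card_borders_ge[OF assms(1), of n] by linarith
    then have "M * 6 \<le> M * card (borders s n)" by simp
    then show False using total tm \<open>\<not> card (balances s n) \<le> 3\<close> by linarith
  qed
  consider "card (borders s n) \<le> 5" | "card (borders s n) = 6" | "card (borders s n) \<ge> 7"
    by linarith
  then show ?thesis
  proof cases
    case 1
    then have "M * card (borders s n) \<le> M * 5" by simp
    then show ?thesis using total assms(2) tm le by linarith
  next
    case 3
    then have "M * 7 \<le> M * card (borders s n)" by simp
    then show ?thesis using total assms(2) tm pos by linarith
  qed (use total in simp)
qed

lemma tm_class_counts_ge_2_imp_tm_balanced:
  assumes "recurrent s" "tm_class_counts (Suc K) s" "K \<ge> 1"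
  shows "tm_balanced s"
proof -
  have M: "(2 :: nat) ^ K - 1 \<ge> 1" "(2 :: nat) ^ Suc K - 1 \<ge> 3"
    using power_increasing[OF assms(3), of "2 :: nat"] by simp_all
  note count = tm_class_counts_Suc_imp_weighted_class_count[OF assms(2)]
  have "card (balances s n) = card (tm_balances n)" if n: "n \<ge> 2" for n
  proof -
    have "aligned s n"
      using aligned_2_if_no_cube_border[OF no_cube_border_if_weighted_class_count[OF count M(1)]] n
      by (rule aligned_mono)
    then have "card (classes (Suc (Suc K)) ((tm_smorph ^^ Suc K) s) (2 ^ Suc K * n)) =
        card (balances s n) + (2 ^ Suc K - 1) * card (borders s n)"
      using card_classes_funpow_tm_smorph(1)[of s n 1 "Suc K"] n
      by (simp add: card_classes_1 card_bordered_classes_1)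
    moreover have "card (classes (Suc (Suc K)) ((tm_smorph ^^ Suc K) s) (2 ^ Suc K * n)) =
        card (tm_balances n) + (2 ^ Suc K - 1) * 6"
      using assms(2) card_classes_thue_morse[OF n] by (simp only: tm_class_counts_def)
    ultimately show ?thesis
      by (intro card_balances_eq_if_total[OF assms(1) M(2)]) (simp only:)
  qed
  then show ?thesis
    using tm_balanced_if_card_balances[OF assms(1)] balances_if_tm_borders_subset(1)
      tm_borders_subset_if_weighted_class_count[OF count] by blast
qed

lemma tm_class_counts_imp_tm_balanced:
  assumes "recurrent s" "tm_class_counts K s"
  shows "tm_balanced s"
proof -
  consider "K = 0" | "K = 1" | L where "K = Suc L" "L \<ge> 1"
    by (cases K; cases "K - 1") auto
  then show ?thesis
    using assms tm_class_counts_0_imp_tm_balanced tm_class_counts_1_imp_tm_balanced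
      tm_class_counts_ge_2_imp_tm_balanced by cases auto
qed

subsection \<open>Desubstitution\<close>

lemma funpow_tm_smorph_sdrop:
  "(tm_smorph ^^ K) (sdrop i s) = sdrop (2 ^ K * i) ((tm_smorph ^^ K) s)"
  by (induction K) (simp_all add: mult.assoc flip: sdrop_tm_smorph)

lemma binom_complexity_eq_if_factors_eq:
  "factors x = factors y \<Longrightarrow> binom_complexity j x = binom_complexity j y"
  by (simp add: binom_complexity_def fun_eq_iff)

lemma recurrent_TM_imp_desubstitution:
  assumes "recurrent x" "TM k x" "K \<le> k"
  shows "\<exists>r<2 ^ K. \<exists>s. recurrent s \<and> x = sdrop r ((tm_smorph ^^ K) s)"
  using assms(3)
proof (induction K)
  case 0
  then show ?case using assms(1) by (auto intro: exI[of _ x])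
next
  case (Suc K)
  then obtain r s where r: "r < 2 ^ K" and s: "recurrent s"
    and x: "x = sdrop r ((tm_smorph ^^ K) s)"
    by auto
  have "binom_complexity (Suc K) ((tm_smorph ^^ K) s) = binom_complexity (Suc K) x"
    unfolding x
    by (rule binom_complexity_eq_if_factors_eq)
      (simp add: recurrent_imp_factors_sdrop recurrent_funpow_tm_smorph s)
  also have "\<dots> = binom_complexity (Suc K) ((tm_smorph ^^ K) thue_morse)"
    using assms(2) Suc.prems by (simp add: TM_def funpow_tm_smorph_thue_morse)
  finally have "tm_class_counts K s"
    by (metis tm_class_counts_def binom_complexity_funpow_tm_smorph funpow_tm_smorph_thue_morse)
  then have "tm_balanced s" by (rule tm_class_counts_imp_tm_balanced[OF s])
  then have "balances s n \<subseteq> {- 1, 1}" if "odd n" for n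
    using that odd_pos[OF that] by (simp add: tm_balanced_def tm_balances_def)
  then obtain d z where z: "d \<le> 1" "recurrent z" "s = sdrop d (tm_smorph z)"
    using odd_balances_imp_desubstitution[OF s] by blast
  have "x = sdrop (2 ^ K * d + r) ((tm_smorph ^^ Suc K) z)"
    by (simp add: x z(3) funpow_tm_smorph_sdrop funpow_swap1)
  moreover have "2 ^ K * d \<le> 2 ^ K" using z(1) by simp
  then have "2 ^ K * d + r < 2 ^ Suc K" using r unfolding power_Suc by linarith
  ultimately show ?case using z(2) by blast
qed

lemma length_funpow_tm_morph: "length ((tm_morph ^^ k) u) = 2 ^ k * length u"
  by (induction k) simp_all

lemma tm_smorph_shift: "tm_smorph (u @- s) = tm_morph u @- tm_smorph s"
  by (induction u) (simp_all add: tm_smorph_SCons)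

lemma funpow_tm_smorph_SCons:
  "(tm_smorph ^^ k) (a ## s) = (tm_morph ^^ k) [a] @- (tm_smorph ^^ k) s"
proof -
  have "(tm_smorph ^^ k) (u @- s) = (tm_morph ^^ k) u @- (tm_smorph ^^ k) s" for u
    by (induction k) (simp_all add: tm_smorph_shift)
  from this[of "[a]"] show ?thesis by simp
qed

lemma sdrop_funpow_tm_smorph:
  assumes "r < 2 ^ k"
  shows "\<exists>y u a. sdrop r ((tm_smorph ^^ k) s) = u @- (tm_smorph ^^ k) y \<and>
    strict_suffix u ((tm_morph ^^ k) [a])"
proof (cases "r = 0")
  case True
  have "(tm_morph ^^ k) [False] \<noteq> []" using length_funpow_tm_morph[of k "[False]"] by auto
  then have "sdrop r ((tm_smorph ^^ k) s) = [] @- (tm_smorph ^^ k) s \<and>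
      strict_suffix [] ((tm_morph ^^ k) [False])"
    using True by (simp add: strict_suffix_def)
  then show ?thesis by blast
next
  case False
  let ?w = "(tm_morph ^^ k) [shd s]"
  have len: "r < length ?w" using assms by (simp add: length_funpow_tm_morph)
  have "(tm_smorph ^^ k) s = ?w @- (tm_smorph ^^ k) (stl s)"
    using funpow_tm_smorph_SCons[of k "shd s" "stl s"] by simp
  then have "sdrop r ((tm_smorph ^^ k) s) = drop r ?w @- (tm_smorph ^^ k) (stl s)"
    using len by (simp add: sdrop_shift)
  moreover have "length (drop r ?w) < length ?w" using len False by simp
  then have "drop r ?w \<noteq> ?w" by (metis less_irrefl)
  then have "strict_suffix (drop r ?w) ?w" by (simp add: strict_suffix_def suffix_drop)
  ultimately show ?thesis by blast
qed

theorem theorem5p2: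
  fixes x :: "bool stream" and k :: nat
  assumes "recurrent x"
    and "k \<ge> 1"
    and "TM k x"
  shows "\<exists>y u. x = u @- (tm_smorph ^^ k) y \<and>
           (strict_suffix u ((tm_morph ^^ k) [False]) \<or> strict_suffix u ((tm_morph ^^ k) [True]))"
proof -
  obtain r s where "r < 2 ^ k" and x: "x = sdrop r ((tm_smorph ^^ k) s)"
    using recurrent_TM_imp_desubstitution[OF assms(1,3) order_refl] by blast
  then obtain y u a where "x = u @- (tm_smorph ^^ k) y" "strict_suffix u ((tm_morph ^^ k) [a])"
    using sdrop_funpow_tm_smorph by metis
  then show ?thesis by (cases a) auto
qed

end
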